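(* Let $t$ be a closed System T term of type $(\iota\Rightarrow\iota)\Rightarrow\iota$ and let $m:=[\![\mathsf{modulusUni}^T\,(\mathsf{dialogueTree}_\iota(t))]\!]\in\mathbb{N}$. Then $m$ is a modulus of uniform continuity of $[\![t]\!]\circ\mathsf{embed}:(\mathbb{N}\to\mathbb{B})\to\mathbb{N}$, i.e. for all $\alpha,\beta:\mathbb{N}\to\mathbb{B}$, if $\alpha(i)=\beta(i)$ for all $i<m$ then $[\![t]\!](\mathsf{embed}\,\alpha)=[\![t]\!](\mathsf{embed}\,\beta)$.
   Context: Metatheory: constructive Martin-Löf type theory without function extensionality; $\mathbb{B}$ is the type of booleans; $\mathsf{Natrec}\,f\,x\,0=x$, $\mathsf{Natrec}\,f\,x\,(n+1)=f\,n\,(\mathsf{Natrec}\,f\,x\,n)$. $\mathsf{embed}:(\mathbb{N}\to\mathbb{B})\to(\mathbb{N}\to\mathbb{N})$ is $\mathsf{embed}\,\alpha\,i=0$ if $\alpha\,i=\mathsf{false}$ and $1$ if $\alpha\,i=\mathsf{true}$. System T: types generated by base type $\iota$ and $\sigma\Rightarrow\tau$; terms: variables, $\mathsf{zero}:\iota$, $\mathsf{succ}\,t$, $\mathsf{rec}_\sigma\,t\,p\,q:\sigma$ ($t:\iota\Rightarrow\sigma\Rightarrow\sigma$, $p:\sigma$, $q:\iota$), $\lambda$-abstraction and application. Set interpretation: $[\![\iota]\!]=\mathbb{N}$, $[\![\sigma\Rightarrow\tau]\!]=[\![\sigma]\!]\to[\![\tau]\!]$, $[\![\mathsf{zero}]\!]=0$,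 $[\![\mathsf{succ}\,t]\!]\gamma=[\![t]\!]\gamma+1$, $[\![\mathsf{rec}_\sigma t_1t_2t_3]\!]\gamma=\mathsf{Natrec}([\![t_1]\!]\gamma)([\![t_2]\!]\gamma)([\![t_3]\!]\gamma)$, standard clauses otherwise; $[\![t]\!]$ for closed $t$. Numerals: $\underline0=\mathsf{zero}$, $\underline{n+1}=\mathsf{succ}\,\underline n$. Internal dialogue trees: $\mathsf{ChD}_A(\sigma):=(\sigma\Rightarrow A)\Rightarrow((\iota\Rightarrow A)\Rightarrow\iota\Rightarrow A)\Rightarrow A$; $\eta_A:=\lambda z\,e\,b.\,e\,z$; $\beta_A:=\lambda\varphi\,x\,e\,b.\,b\,(\lambda y.\varphi\,y\,e\,b)\,x$; $K_A:=\lambda f\,d\,e'\,b'.\,d\,(\lambda x.f\,x\,e'\,b')\,b'$; $\mathsf{map}_A:=\lambda f.K_A(\lambda x.\eta_A(f\,x))$. $\lceil\iota\rceil_A=\mathsf{ChD}_A(\iota)$, $\lceil\sigma\Rightarrow\tau\rceil_A=\lceil\sigma\rceil_A\Rightarrow\lceil\tau\rceil_A$. $\mathsf{ext}^T_{\iota,A}:=K_A$, $\mathsf{ext}^T_{\sigma_1\Rightarrow\sigma_2,A}:=\lambda f\,d\,s.\mathsf{ext}^T_{\sigma_2,A}(\lambda x.f\,x\,s)\,d$. Term translation: $\lceil x\rceil_A=x$, $\lceil\mathsf{zero}\rceil_A=\eta_A\,\mathsf{zero}$, $\lceil\mathsf{succ}\,t\rceil_A=\mathsf{map}_A(\lambda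 n.\mathsf{succ}\,n)\lceil t\rceil_A$, $\lceil\mathsf{rec}_\sigma t_1t_2t_3\rceil_A=\mathsf{ext}^T_{\sigma,A}(\lambda n.\mathsf{rec}_{\lceil\sigma\rceil_A}(\lambda x.\lceil t_1\rceil_A(\eta_A x))\lceil t_2\rceil_A\,n)\lceil t_3\rceil_A$, $\lambda$ and application homomorphically. $\mathsf{generic}_A:=K_A(\lambda i.\beta_A\,\eta_A\,i)$; $\mathsf{dialogueTree}_A(t):=\lceil t\rceil_A\,\mathsf{generic}_A$. Fix a closed term $\mathsf{max}^T:\iota\Rightarrow\iota\Rightarrow\iota$ with $[\![\mathsf{max}^T]\!]\,a\,b=\max(a,b)$. $\mathsf{maxBQ}^T:=\lambda d.\,d\,(\lambda w.\mathsf{zero})\,(\lambda g\,x.\,\mathsf{max}^T\,x\,(\mathsf{max}^T\,(g\,\underline0)\,(g\,\underline1)))$ of type $\mathsf{ChD}_\iota(\iota)\Rightarrow\iota$, and $\mathsf{modulusUni}^T:=\lambda d.\,\mathsf{succ}(\mathsf{maxBQ}^T\,d)$. *)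

theory Defs
  imports Main "HOL-Library.FuncSet"
begin

section \<open>System T\<close>

datatype ty = Iota (\<open>\<iota>\<close>) | Arr ty ty (infixr \<open>\<Rrightarrow>\<close> 60)

text \<open>Terms use de Bruijn indices; \<open>\<lambda>\<close> and \<open>rec\<close> carry type annotations, so types are unique.\<close>

datatype tm =
    Var nat
  | Zero
  | Succ tm
  | Rec ty tm tm tm
  | Lam ty tm
  | App tm tm (infixl \<open>\<cdot>\<close> 100)

inductive wt :: "ty list \<Rightarrow> tm \<Rightarrow> ty \<Rightarrow> bool" (\<open>_ \<turnstile> _ : _\<close> [50, 50, 50] 50) where
  wt_Var: "i < length \<Gamma> \<Longrightarrow> \<Gamma> ! i = \<sigma> \<Longrightarrow> \<Gamma> \<turnstile> Var i : \<sigma>"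
| wt_Zero: "\<Gamma> \<turnstile> Zero : \<iota>"
| wt_Succ: "\<Gamma> \<turnstile> t : \<iota> \<Longrightarrow> \<Gamma> \<turnstile> Succ t : \<iota>"
| wt_Rec: "\<Gamma> \<turnstile> t : \<iota> \<Rrightarrow> \<sigma> \<Rrightarrow> \<sigma> \<Longrightarrow> \<Gamma> \<turnstile> p : \<sigma> \<Longrightarrow> \<Gamma> \<turnstile> q : \<iota> \<Longrightarrow> \<Gamma> \<turnstile> Rec \<sigma> t p q : \<sigma>"
| wt_Lam: "\<sigma> # \<Gamma> \<turnstile> t : \<tau> \<Longrightarrow> \<Gamma> \<turnstile> Lam \<sigma> t : \<sigma> \<Rrightarrow> \<tau>"
| wt_App: "\<Gamma> \<turnstile> t : \<sigma> \<Rrightarrow> \<tau> \<Longrightarrow> \<Gamma> \<turnstile> u : \<sigma> \<Longrightarrow> \<Gamma> \<turnstile> t \<cdot> u : \<tau>"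

primrec numeral_tm :: "nat \<Rightarrow> tm" where
  "numeral_tm 0 = Zero"
| "numeral_tm (Suc n) = Succ (numeral_tm n)"

text \<open>\<open>lift k t\<close> weakens \<open>t\<close> by a fresh variable at index \<open>k\<close>.\<close>

primrec lift :: "nat \<Rightarrow> tm \<Rightarrow> tm" where
  "lift k (Var i) = Var (if i < k then i else Suc i)"
| "lift k Zero = Zero"
| "lift k (Succ t) = Succ (lift k t)"
| "lift k (Rec \<sigma> t p q) = Rec \<sigma> (lift k t) (lift k p) (lift k q)"
| "lift k (Lam \<sigma> t) = Lam \<sigma> (lift (Suc k) t)"
| "lift k (t \<cdot> u) = lift k t \<cdot> lift k u"

text \<open>The types of all subterms of a typed term.\<close>

primrec occ_types :: "tm \<Rightarrow> ty list \<Rightarrow> ty set" where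
  "occ_types (Var i) \<Gamma> = {\<tau>. \<Gamma> \<turnstile> Var i : \<tau>}"
| "occ_types Zero \<Gamma> = {\<tau>. \<Gamma> \<turnstile> Zero : \<tau>}"
| "occ_types (Succ t) \<Gamma> = {\<tau>. \<Gamma> \<turnstile> Succ t : \<tau>} \<union> occ_types t \<Gamma>"
| "occ_types (Rec \<sigma> t p q) \<Gamma> =
     {\<tau>. \<Gamma> \<turnstile> Rec \<sigma> t p q : \<tau>} \<union> occ_types t \<Gamma> \<union> occ_types p \<Gamma> \<union> occ_types q \<Gamma>"
| "occ_types (Lam \<sigma> t) \<Gamma> = {\<tau>. \<Gamma> \<turnstile> Lam \<sigma> t : \<tau>} \<union> occ_types t (\<sigma> # \<Gamma>)"
| "occ_types (t \<cdot> u) \<Gamma> = {\<tau>. \<Gamma> \<turnstile> t \<cdot> u : \<tau>} \<union> occ_types t \<Gamma> \<union> occ_types u \<Gamma>"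

primrec subtypes :: "ty \<Rightarrow> ty set" where
  "subtypes \<iota> = {\<iota>}"
| "subtypes (\<sigma> \<Rrightarrow> \<tau>) = insert (\<sigma> \<Rrightarrow> \<tau>) (subtypes \<sigma> \<union> subtypes \<tau>)"


section \<open>Set interpretation\<close>

text \<open>
  A dependently typed interpretation function cannot be written in HOL, and the full function
  spaces over all finite types do not fit into a single HOL type. Values are therefore coded in a
  type \<open>'u\<close>: \<open>code\<close> and \<open>ap\<close> turn (extensional) functions on \<open>'u\<close> into elements of \<open>'u\<close> and back.
  The carrier of \<open>\<sigma> \<Rrightarrow> \<tau>\<close> consists of the codes of \<^emph>\<open>all\<close> functions from the carrier of \<open>\<sigma>\<close> to the
  carrier of \<open>\<tau>\<close>. The predicate \<open>set_universe U S\<close> says that the coding is faithful at the types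
  in \<open>S\<close> and their components, so that these carriers are \<open>\<nat>\<close> and genuine full function spaces.
\<close>

record 'u coding =
  num :: "nat \<Rightarrow> 'u"
  code :: "('u \<Rightarrow> 'u) \<Rightarrow> 'u"
  ap :: "'u \<Rightarrow> 'u \<Rightarrow> 'u"

primrec carrier :: "'u coding \<Rightarrow> ty \<Rightarrow> 'u set" where
  "carrier U \<iota> = range (num U)"
| "carrier U (\<sigma> \<Rrightarrow> \<tau>) = code U ` (carrier U \<sigma> \<rightarrow>\<^sub>E carrier U \<tau>)"

definition set_universe :: "'u coding \<Rightarrow> ty set \<Rightarrow> bool" where
  "set_universe U S \<longleftrightarrow> inj (num U) \<and>
     (\<forall>\<rho>\<in>S. \<forall>\<sigma> \<tau>. \<sigma> \<Rrightarrow> \<tau> \<in> subtypes \<rho> \<longrightarrow>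
        (\<forall>f \<in> carrier U \<sigma> \<rightarrow>\<^sub>E carrier U \<tau>. ap U (code U f) = f))"

definition nat_of :: "'u coding \<Rightarrow> 'u \<Rightarrow> nat" where
  "nat_of U = inv (num U)"

primrec interp :: "'u coding \<Rightarrow> tm \<Rightarrow> 'u list \<Rightarrow> 'u" where
  "interp U (Var i) \<gamma> = \<gamma> ! i"
| "interp U Zero \<gamma> = num U 0"
| "interp U (Succ t) \<gamma> = num U (nat_of U (interp U t \<gamma>) + 1)"
| "interp U (Rec \<sigma> t p q) \<gamma> =
     rec_nat (interp U p \<gamma>) (\<lambda>n r. ap U (ap U (interp U t \<gamma>) (num U n)) r)
       (nat_of U (interp U q \<gamma>))"
| "interp U (Lam \<sigma> t) \<gamma> = code U (\<lambda>x\<in>carrier U \<sigma>. interp U t (x # \<gamma>))"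
| "interp U (t \<cdot> u) \<gamma> = ap U (interp U t \<gamma>) (interp U u \<gamma>)"

text \<open>Interpretations of closed terms of low type as HOL objects.\<close>

definition sem_nat :: "'u coding \<Rightarrow> tm \<Rightarrow> nat" where
  "sem_nat U t = nat_of U (interp U t [])"

definition sem_nat2 :: "'u coding \<Rightarrow> tm \<Rightarrow> nat \<Rightarrow> nat \<Rightarrow> nat" where
  "sem_nat2 U t a b = nat_of U (ap U (ap U (interp U t []) (num U a)) (num U b))"

definition code_seq :: "'u coding \<Rightarrow> (nat \<Rightarrow> nat) \<Rightarrow> 'u" where
  "code_seq U f = code U (\<lambda>x\<in>carrier U \<iota>. num U (f (nat_of U x)))"

definition sem_fun :: "'u coding \<Rightarrow> tm \<Rightarrow> (nat \<Rightarrow> nat) \<Rightarrow> nat" where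
  "sem_fun U t f = nat_of U (ap U (interp U t []) (code_seq U f))"


subsection \<open>Existence of codings\<close>

text \<open>
  Every finite set of types has bounded rank, and the two lemmas below provide, for every fixed
  rank, a HOL type with a coding that is faithful at all types of that rank.
\<close>

primrec rank :: "ty \<Rightarrow> nat" where
  "rank \<iota> = 0"
| "rank (\<sigma> \<Rrightarrow> \<tau>) = Suc (max (rank \<sigma>) (rank \<tau>))"

lemma rank_subtypes: "\<sigma> \<in> subtypes \<rho> \<Longrightarrow> rank \<sigma> \<le> rank \<rho>"
  by (induction \<rho>) auto

lemma set_universe_rank_0: "\<exists>U :: nat coding. set_universe U {\<sigma>. rank \<sigma> \<le> 0}"
proof -
  have "set_universe \<lparr>num = id, code = undefined, ap = undefined\<rparr> {\<sigma>. rank \<sigma> \<le> 0}"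
    unfolding set_universe_def using rank_subtypes by fastforce
  then show ?thesis ..
qed

lemma set_universe_rank_Suc:
  fixes U :: "'u coding"
  assumes U: "set_universe U {\<sigma>. rank \<sigma> \<le> n}"
  shows "\<exists>V :: ('u + ('u \<Rightarrow> 'u)) coding. set_universe V {\<sigma>. rank \<sigma> \<le> Suc n}"
proof -
  define sw :: "'u + ('u \<Rightarrow> 'u) \<Rightarrow> 'u + ('u \<Rightarrow> 'u)" where
    "sw = id(Inl undefined := undefined, undefined := Inl undefined)"
  have sw: "inj sw"
    unfolding sw_def inj_def by auto
  define i where "i = (\<lambda>u :: 'u. sw (Inl u))"
  define j where "j = (\<lambda>g :: 'u \<Rightarrow> 'u. sw (Inr g))"
  have ij: "inj i" "inj j" "i u \<noteq> j g" for u g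
    using sw unfolding i_def j_def inj_def by auto
  have i_undef: "i undefined = undefined"
    unfolding i_def sw_def by simp
  have inv_ij [simp]: "inv i (i u) = u" "inv j (j g) = g" for u g
    using ij by auto
  have jni [simp]: "j g \<notin> range i" for g
    using ij(3) by (metis imageE)
  define push where "push = (\<lambda>g w. if w \<in> range i then i (g (inv i w)) else undefined)"
  define pull where "pull = (\<lambda>h u. inv i (h (i u)))"
  define X where "X = {g. \<exists>\<sigma> \<tau>. rank (\<sigma> \<Rrightarrow> \<tau>) \<le> n \<and> g \<in> carrier U \<sigma> \<rightarrow>\<^sub>E carrier U \<tau>}"
  define V where "V = \<lparr>num = i \<circ> num U,
      code = (\<lambda>h. if pull h \<in> X then i (code U (pull h)) else j (pull h)),
      ap = (\<lambda>w. push (if w \<in> range i then ap U (inv i w) else inv j w))\<rparr>"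
  have self: "\<rho> \<in> subtypes \<rho>" for \<rho> by (cases \<rho>) auto
  have X: "ap U (code U g) = g" if "g \<in> X" for g
    using U that self unfolding set_universe_def X_def by blast
  have pull_in: "pull h \<in> A \<rightarrow>\<^sub>E B" and push_pull: "push (pull h) = h"
    if h: "h \<in> i ` A \<rightarrow>\<^sub>E i ` B" for h A B
  proof -
    have "pull h u \<in> B" if "u \<in> A" for u
      using PiE_mem[OF h, of "i u"] that unfolding pull_def by auto
    moreover have "pull h u = undefined" if "u \<notin> A" for u
    proof -
      have "i u \<notin> i ` A" using that ij(1) by (auto dest: injD)
      then have "h (i u) = i undefined" using h i_undef by (metis PiE_arb)
      then show ?thesis unfolding pull_def by simp
    qed
    ultimately show "pull h \<in> A \<rightarrow>\<^sub>E B" by auto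
    show "push (pull h) = h"
    proof
      fix w
      show "push (pull h) w = h w"
      proof (cases "w \<in> i ` A")
        case True
        then obtain u where u: "w = i u" "u \<in> A" by auto
        obtain v where "h w = i v" using PiE_mem[OF h True] by auto
        then show ?thesis using u unfolding push_def pull_def by simp
      next
        case False
        then have "h w = undefined" using h by (metis PiE_arb)
        moreover have "i (inv i undefined) = undefined"
          using i_undef inv_ij(1)[of undefined] by simp
        ultimately show ?thesis unfolding push_def pull_def by auto
      qed
    qed
  qed
  have pull_push: "pull (push g) = g" for g
    unfolding push_def pull_def by simp
  have push_in: "push g \<in> i ` A \<rightarrow>\<^sub>E i ` B" if "g \<in> A \<rightarrow>\<^sub>E B" for g A B
  proof (rule PiE_I)
    fix w assume "w \<in> i ` A"
    then obtain u where "w = i u" "u \<in> A" by auto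
    moreover from this have "g u \<in> B" using that by blast
    ultimately show "push g w \<in> i ` B" unfolding push_def by simp
  next
    fix w assume w: "w \<notin> i ` A"
    show "push g w = undefined"
    proof (cases "w \<in> range i")
      case True
      then obtain u where u: "w = i u" by auto
      with w have "u \<notin> A" by auto
      then have "g u = undefined" using that by (metis PiE_arb)
      then show ?thesis using u i_undef unfolding push_def by simp
    qed (simp add: push_def)
  qed
  have car: "rank \<sigma> \<le> n \<Longrightarrow> carrier V \<sigma> = i ` carrier U \<sigma>" for \<sigma>
  proof (induction \<sigma>)
    case Iota
    show ?case by (auto simp: V_def)
  next
    case (Arr \<sigma> \<tau>)
    then have IH: "carrier V \<sigma> = i ` carrier U \<sigma>" "carrier V \<tau> = i ` carrier U \<tau>" by auto
    have inX: "g \<in> X" if "g \<in> carrier U \<sigma> \<rightarrow>\<^sub>E carrier U \<tau>" for g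
      using that Arr.prems unfolding X_def by blast
    show ?case
    proof (intro set_eqI iffI)
      fix w assume "w \<in> carrier V (\<sigma> \<Rrightarrow> \<tau>)"
      then obtain h where h: "w = code V h" "h \<in> i ` carrier U \<sigma> \<rightarrow>\<^sub>E i ` carrier U \<tau>"
        using IH by auto
      then show "w \<in> i ` carrier U (\<sigma> \<Rrightarrow> \<tau>)"
        using pull_in[OF h(2)] inX by (auto simp: V_def)
    next
      fix w assume "w \<in> i ` carrier U (\<sigma> \<Rrightarrow> \<tau>)"
      then obtain g where g: "w = i (code U g)" "g \<in> carrier U \<sigma> \<rightarrow>\<^sub>E carrier U \<tau>" by auto
      then have "w = code V (push g)" using inX by (simp add: V_def pull_push)
      then show "w \<in> carrier V (\<sigma> \<Rrightarrow> \<tau>)" using push_in[OF g(2)] IH by auto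
    qed
  qed
  have "ap V (code V h) = h"
    if "rank \<rho> \<le> Suc n" "\<sigma> \<Rrightarrow> \<tau> \<in> subtypes \<rho>" "h \<in> carrier V \<sigma> \<rightarrow>\<^sub>E carrier V \<tau>" for \<rho> \<sigma> \<tau> h
  proof -
    have "rank \<sigma> \<le> n" "rank \<tau> \<le> n" using rank_subtypes[OF that(2)] that(1) by auto
    then have "push (pull h) = h" using push_pull that(3) car by simp
    then show ?thesis by (simp add: V_def X)
  qed
  moreover have "inj (num V)"
    using ij(1) U unfolding V_def set_universe_def by (simp add: inj_compose)
  ultimately show ?thesis unfolding set_universe_def by blast
qed


section \<open>Internal dialogue trees\<close>

text \<open>
  The untyped combinators of the informal presentation become families indexed by the types they
  are used at: \<open>A\<close> is the answer type, \<open>\<sigma>\<close> and \<open>\<tau>\<close> are leaf types.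
\<close>

definition ChD :: "ty \<Rightarrow> ty \<Rightarrow> ty" where
  "ChD A \<sigma> = (\<sigma> \<Rrightarrow> A) \<Rrightarrow> ((\<iota> \<Rrightarrow> A) \<Rrightarrow> \<iota> \<Rrightarrow> A) \<Rrightarrow> A"

text \<open>\<open>\<lambda>z e b. e z\<close>\<close>

definition eta :: "ty \<Rightarrow> ty \<Rightarrow> tm" where
  "eta A \<sigma> = Lam \<sigma> (Lam (\<sigma> \<Rrightarrow> A) (Lam ((\<iota> \<Rrightarrow> A) \<Rrightarrow> \<iota> \<Rrightarrow> A) (Var 1 \<cdot> Var 2)))"

text \<open>\<open>\<lambda>\<phi> x e b. b (\<lambda>y. \<phi> y e b) x\<close>\<close>

definition beta :: "ty \<Rightarrow> ty \<Rightarrow> tm" where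
  "beta A \<sigma> =
     Lam (\<iota> \<Rrightarrow> ChD A \<sigma>) (Lam \<iota> (Lam (\<sigma> \<Rrightarrow> A) (Lam ((\<iota> \<Rrightarrow> A) \<Rrightarrow> \<iota> \<Rrightarrow> A)
       (Var 0 \<cdot> Lam \<iota> (Var 4 \<cdot> Var 0 \<cdot> Var 2 \<cdot> Var 1) \<cdot> Var 2))))"

text \<open>\<open>\<lambda>f d e' b'. d (\<lambda>x. f x e' b') b'\<close>\<close>

definition kleisli :: "ty \<Rightarrow> ty \<Rightarrow> ty \<Rightarrow> tm" where
  "kleisli A \<sigma> \<tau> =
     Lam (\<sigma> \<Rrightarrow> ChD A \<tau>) (Lam (ChD A \<sigma>) (Lam (\<tau> \<Rrightarrow> A) (Lam ((\<iota> \<Rrightarrow> A) \<Rrightarrow> \<iota> \<Rrightarrow> A)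
       (Var 2 \<cdot> Lam \<sigma> (Var 4 \<cdot> Var 0 \<cdot> Var 2 \<cdot> Var 1) \<cdot> Var 0))))"

text \<open>\<open>\<lambda>f. K (\<lambda>x. \<eta> (f x))\<close>\<close>

definition map_tm :: "ty \<Rightarrow> ty \<Rightarrow> ty \<Rightarrow> tm" where
  "map_tm A \<sigma> \<tau> = Lam (\<sigma> \<Rrightarrow> \<tau>) (kleisli A \<sigma> \<tau> \<cdot> Lam \<sigma> (eta A \<tau> \<cdot> (Var 1 \<cdot> Var 0)))"

primrec trans_ty :: "ty \<Rightarrow> ty \<Rightarrow> ty" where
  "trans_ty A \<iota> = ChD A \<iota>"
| "trans_ty A (\<sigma> \<Rrightarrow> \<tau>) = trans_ty A \<sigma> \<Rrightarrow> trans_ty A \<tau>"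

text \<open>\<open>\<lambda>f d s. ext (\<lambda>x. f x s) d\<close> at function types\<close>

primrec ext_tm :: "ty \<Rightarrow> ty \<Rightarrow> tm" where
  "ext_tm A \<iota> = kleisli A \<iota> \<iota>"
| "ext_tm A (\<sigma> \<Rrightarrow> \<tau>) =
     Lam (\<iota> \<Rrightarrow> trans_ty A (\<sigma> \<Rrightarrow> \<tau>)) (Lam (ChD A \<iota>) (Lam (trans_ty A \<sigma>)
       (ext_tm A \<tau> \<cdot> Lam \<iota> (Var 3 \<cdot> Var 0 \<cdot> Var 1) \<cdot> Var 1)))"

primrec trans_tm :: "ty \<Rightarrow> tm \<Rightarrow> tm" where
  "trans_tm A (Var i) = Var i"
| "trans_tm A Zero = eta A \<iota> \<cdot> Zero"
| "trans_tm A (Succ t) = map_tm A \<iota> \<iota> \<cdot> Lam \<iota> (Succ (Var 0)) \<cdot> trans_tm A t"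
| "trans_tm A (Rec \<sigma> t p q) =
     ext_tm A \<sigma>
     \<cdot> Lam \<iota> (Rec (trans_ty A \<sigma>)
         (Lam \<iota> (lift 0 (lift 0 (trans_tm A t)) \<cdot> (eta A \<iota> \<cdot> Var 0)))
         (lift 0 (trans_tm A p))
         (Var 0))
     \<cdot> trans_tm A q"
| "trans_tm A (Lam \<sigma> t) = Lam (trans_ty A \<sigma>) (trans_tm A t)"
| "trans_tm A (t \<cdot> u) = trans_tm A t \<cdot> trans_tm A u"

definition generic :: "ty \<Rightarrow> tm" where
  "generic A = kleisli A \<iota> \<iota> \<cdot> Lam \<iota> (beta A \<iota> \<cdot> eta A \<iota> \<cdot> Var 0)"

definition dialogue_tree :: "ty \<Rightarrow> tm \<Rightarrow> tm" where
  "dialogue_tree A t = trans_tm A t \<cdot> generic A"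


section \<open>Moduli of uniform continuity\<close>

text \<open>The argument \<open>mx\<close> is a closed term for the maximum function; it needs no lifting under binders.\<close>

definition max_bq :: "tm \<Rightarrow> tm" where
  "max_bq mx =
     Lam (ChD \<iota> \<iota>)
       (Var 0 \<cdot> Lam \<iota> Zero
        \<cdot> Lam (\<iota> \<Rrightarrow> \<iota>) (Lam \<iota>
            (mx \<cdot> Var 0 \<cdot> (mx \<cdot> (Var 1 \<cdot> numeral_tm 0) \<cdot> (Var 1 \<cdot> numeral_tm 1)))))"

definition modulus_uni :: "tm \<Rightarrow> tm" where
  "modulus_uni mx = Lam (ChD \<iota> \<iota>) (Succ (max_bq mx \<cdot> Var 0))"

definition embed_bool :: "(nat \<Rightarrow> bool) \<Rightarrow> nat \<Rightarrow> nat" where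
  "embed_bool \<alpha> i = (if \<alpha> i then 1 else 0)"

definition is_modulus_of_uniform_continuity :: "nat \<Rightarrow> ((nat \<Rightarrow> bool) \<Rightarrow> nat) \<Rightarrow> bool" where
  "is_modulus_of_uniform_continuity m F \<longleftrightarrow>
     (\<forall>\<alpha> \<beta>. (\<forall>i<m. \<alpha> i = \<beta> i) \<longrightarrow> F \<alpha> = F \<beta>)"

end

theory Submission
  imports Defs
begin

text \<open>
  Every value of type \<open>(\<iota> \<Rrightarrow> \<iota>) \<Rrightarrow> \<iota>\<close> definable in System T is computed by a well-founded tree of
  queries to its argument. A logical relation between families of values, indexed by the argument
  \<open>\<alpha>\<close>, and values of the translated type shows that the internal dialogue tree of \<open>t\<close> is the Church
  encoding of such a tree \<open>T\<close>: at base type, \<open>x\<close> is related to \<open>d\<close> if \<open>d\<close> encodes some \<open>T\<close> that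
  answers \<open>x \<alpha>\<close> for all \<open>\<alpha>\<close> simultaneously. The generic element is related to the family of all
  arguments. On encodings, \<open>max_bq\<close> computes the largest query occurring in the
  Boolean part of \<open>T\<close>, and two Boolean sequences that agree up to it follow the same path in \<open>T\<close>.
\<close>

section \<open>Typing\<close>

text \<open>The annotations on \<open>Lam\<close> and \<open>Rec\<close> make typing
  syntax-directed, so every rule can be inverted; as rewrite rules the inversions let the simplifier
  check types.\<close>

lemma wt_simps [simp]:
  "\<Gamma> \<turnstile> Var i : \<tau> \<longleftrightarrow> i < length \<Gamma> \<and> \<Gamma> ! i = \<tau>"
  "\<Gamma> \<turnstile> Zero : \<tau> \<longleftrightarrow> \<tau> = \<iota>"
  "\<Gamma> \<turnstile> Succ t : \<tau> \<longleftrightarrow> \<tau> = \<iota> \<and> \<Gamma> \<turnstile> t : \<iota>"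
  "\<Gamma> \<turnstile> Rec \<sigma> t p q : \<tau> \<longleftrightarrow> \<tau> = \<sigma> \<and> \<Gamma> \<turnstile> t : \<iota> \<Rrightarrow> \<sigma> \<Rrightarrow> \<sigma> \<and> \<Gamma> \<turnstile> p : \<sigma> \<and> \<Gamma> \<turnstile> q : \<iota>"
  "\<Gamma> \<turnstile> Lam \<sigma> t : \<tau> \<longleftrightarrow> (\<exists>\<rho>. \<tau> = \<sigma> \<Rrightarrow> \<rho> \<and> \<sigma> # \<Gamma> \<turnstile> t : \<rho>)"
  "\<Gamma> \<turnstile> t \<cdot> u : \<tau> \<longleftrightarrow> (\<exists>\<sigma>. \<Gamma> \<turnstile> t : \<sigma> \<Rrightarrow> \<tau> \<and> \<Gamma> \<turnstile> u : \<sigma>)"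
  by (auto elim: wt.cases intro: wt.intros)

text \<open>The insertion point is arbitrary because the \<open>Lam\<close> case lengthens the
  prefix. The equivalence, rather than one direction, lets \<open>occ_types_lift\<close> compare
  whole sets of types.\<close>

lemma wt_lift: "\<Gamma> @ \<rho> # \<Delta> \<turnstile> lift (length \<Gamma>) t : \<tau> \<longleftrightarrow> \<Gamma> @ \<Delta> \<turnstile> t : \<tau>"
proof (induction t arbitrary: \<Gamma> \<tau>)
  case (Lam \<sigma> t)
  from Lam[of "\<sigma> # \<Gamma>"] show ?case by simp
qed (auto simp: nth_append)

lemma wt_lift_0 [simp]: "\<rho> # \<Delta> \<turnstile> lift 0 t : \<tau> \<longleftrightarrow> \<Delta> \<turnstile> t : \<tau>"
  using wt_lift[of "[]"] by simp

text \<open>New entries go to the outer end of the context, where no de Bruijn index moves. This is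
  why a closed \<open>mx\<close> may stand under binders without lifting.\<close>

lemma wt_weaken: "\<Gamma> \<turnstile> t : \<tau> \<Longrightarrow> \<Gamma> @ \<Delta> \<turnstile> t : \<tau>"
  by (induction rule: wt.induct) (auto simp: nth_append)

lemma wt_closed: "[] \<turnstile> t : \<tau> \<Longrightarrow> \<Gamma> \<turnstile> t : \<tau>"
  using wt_weaken[of "[]"] by simp

lemma wt_unique: "\<Gamma> \<turnstile> t : \<sigma> \<Longrightarrow> \<Gamma> \<turnstile> t : \<tau> \<Longrightarrow> \<sigma> = \<tau>"
proof (induction t arbitrary: \<Gamma> \<sigma> \<tau>)
  case (Lam \<rho> t)
  from Lam.prems obtain \<sigma>' \<tau>' where "\<sigma> = \<rho> \<Rrightarrow> \<sigma>'" "\<tau> = \<rho> \<Rrightarrow> \<tau>'"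
    "\<rho> # \<Gamma> \<turnstile> t : \<sigma>'" "\<rho> # \<Gamma> \<turnstile> t : \<tau>'"
    by auto
  then show ?case using Lam.IH by blast
next
  case (App t u)
  from App.prems obtain \<sigma>' \<tau>' where "\<Gamma> \<turnstile> t : \<sigma>' \<Rrightarrow> \<sigma>" "\<Gamma> \<turnstile> t : \<tau>' \<Rrightarrow> \<tau>"
    by auto
  from App.IH(1)[OF this] show ?case by simp
qed auto

lemma occ_types_lift:
  "occ_types (lift (length \<Gamma>) t) (\<Gamma> @ \<rho> # \<Delta>) = occ_types t (\<Gamma> @ \<Delta>)"
proof (induction t arbitrary: \<Gamma>)
  case (Lam \<sigma> t)
  from Lam[of "\<sigma> # \<Gamma>"] wt_lift[of \<Gamma> \<rho> \<Delta> "Lam \<sigma> t"] show ?case by simp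
next
  case (Var i)
  from wt_lift[of \<Gamma> \<rho> \<Delta> "Var i"] show ?case by (simp del: wt_simps)
next
  case (Rec \<sigma> t p q)
  with wt_lift[of \<Gamma> \<rho> \<Delta> "Rec \<sigma> t p q"] show ?case by (simp del: wt_simps)
next
  case (App t u)
  with wt_lift[of \<Gamma> \<rho> \<Delta> "t \<cdot> u"] show ?case by (simp del: wt_simps)
next
  case (Succ t)
  with wt_lift[of \<Gamma> \<rho> \<Delta> "Succ t"] show ?case by (simp del: wt_simps)
qed simp

text \<open>As for the combinators that follow, the exact type in any context settles the argument
  type that the rule for applications leaves open.\<close>

lemma wt_eta [simp]: "\<Gamma> \<turnstile> eta A \<sigma> : \<tau> \<longleftrightarrow> \<tau> = \<sigma> \<Rrightarrow> ChD A \<sigma>"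
  by (auto simp: eta_def ChD_def)

lemma wt_beta [simp]: "\<Gamma> \<turnstile> beta A \<sigma> : \<tau> \<longleftrightarrow> \<tau> = (\<iota> \<Rrightarrow> ChD A \<sigma>) \<Rrightarrow> \<iota> \<Rrightarrow> ChD A \<sigma>"
  by (auto simp: beta_def ChD_def)

lemma wt_kleisli [simp]:
  "\<Gamma> \<turnstile> kleisli A \<sigma> \<rho> : \<tau> \<longleftrightarrow> \<tau> = (\<sigma> \<Rrightarrow> ChD A \<rho>) \<Rrightarrow> ChD A \<sigma> \<Rrightarrow> ChD A \<rho>"
  by (auto simp: kleisli_def ChD_def)

lemma wt_map_tm [simp]:
  "\<Gamma> \<turnstile> map_tm A \<sigma> \<rho> : \<tau> \<longleftrightarrow> \<tau> = (\<sigma> \<Rrightarrow> \<rho>) \<Rrightarrow> ChD A \<sigma> \<Rrightarrow> ChD A \<rho>"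
  by (auto simp: map_tm_def)

lemma wt_generic [simp]: "\<Gamma> \<turnstile> generic A : \<tau> \<longleftrightarrow> \<tau> = ChD A \<iota> \<Rrightarrow> ChD A \<iota>"
  by (auto simp: generic_def)

lemma wt_ext_tm [simp]:
  "\<Gamma> \<turnstile> ext_tm A \<sigma> : \<tau> \<longleftrightarrow> \<tau> = (\<iota> \<Rrightarrow> trans_ty A \<sigma>) \<Rrightarrow> ChD A \<iota> \<Rrightarrow> trans_ty A \<sigma>"
  by (induction \<sigma> arbitrary: \<Gamma> \<tau>) auto

lemma wt_trans_tm:
  "\<Gamma> \<turnstile> t : \<tau> \<Longrightarrow> map (trans_ty A) \<Gamma> \<turnstile> trans_tm A t : trans_ty A \<tau>"
  by (induction rule: wt.induct) auto

section \<open>Faithful types\<close>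

primrec faithful :: "'u coding \<Rightarrow> ty \<Rightarrow> bool" where
  "faithful U \<iota> \<longleftrightarrow> True"
| "faithful U (\<sigma> \<Rrightarrow> \<tau>) \<longleftrightarrow> faithful U \<sigma> \<and> faithful U \<tau> \<and>
     (\<forall>f \<in> carrier U \<sigma> \<rightarrow>\<^sub>E carrier U \<tau>. ap U (code U f) = f)"

lemma faithfulI:
  "\<forall>\<sigma> \<tau>. \<sigma> \<Rrightarrow> \<tau> \<in> subtypes \<rho> \<longrightarrow>
     (\<forall>f \<in> carrier U \<sigma> \<rightarrow>\<^sub>E carrier U \<tau>. ap U (code U f) = f) \<Longrightarrow> faithful U \<rho>"
  by (induction \<rho>) simp_all

text \<open>Only the types that occur in the given terms are known to be faithful, so the condition
  is attached to a term in context and is inherited by its subterms.\<close>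

definition faithful_tm :: "'u coding \<Rightarrow> ty list \<Rightarrow> tm \<Rightarrow> bool" where
  "faithful_tm U \<Gamma> t \<longleftrightarrow> (\<forall>\<rho> \<in> occ_types t \<Gamma>. faithful U \<rho>)"

lemma faithful_tm_simps [simp]:
  "faithful_tm U \<Gamma> (Var i) \<longleftrightarrow> (i < length \<Gamma> \<longrightarrow> faithful U (\<Gamma> ! i))"
  "faithful_tm U \<Gamma> Zero"
  "faithful_tm U \<Gamma> (Succ t) \<longleftrightarrow> faithful_tm U \<Gamma> t"
  "faithful_tm U \<Gamma> (Rec \<sigma> t p q) \<longleftrightarrow> (\<forall>\<tau>. \<Gamma> \<turnstile> Rec \<sigma> t p q : \<tau> \<longrightarrow> faithful U \<tau>) \<and>
     faithful_tm U \<Gamma> t \<and> faithful_tm U \<Gamma> p \<and> faithful_tm U \<Gamma> q"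
  "faithful_tm U \<Gamma> (Lam \<sigma> t) \<longleftrightarrow> (\<forall>\<tau>. \<Gamma> \<turnstile> Lam \<sigma> t : \<tau> \<longrightarrow> faithful U \<tau>) \<and>
     faithful_tm U (\<sigma> # \<Gamma>) t"
  "faithful_tm U \<Gamma> (t \<cdot> u) \<longleftrightarrow> (\<forall>\<tau>. \<Gamma> \<turnstile> t \<cdot> u : \<tau> \<longrightarrow> faithful U \<tau>) \<and>
     faithful_tm U \<Gamma> t \<and> faithful_tm U \<Gamma> u"
  by (auto simp: faithful_tm_def)

lemma faithful_tm_type: "faithful_tm U \<Gamma> t \<Longrightarrow> \<Gamma> \<turnstile> t : \<tau> \<Longrightarrow> faithful U \<tau>"
  by (cases t) (simp_all add: faithful_tm_def del: wt_simps)

lemma faithful_tm_lift_0 [simp]: "faithful_tm U (\<rho> # \<Delta>) (lift 0 t) \<longleftrightarrow> faithful_tm U \<Delta> t"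
  using occ_types_lift[of "[]"] by (simp add: faithful_tm_def)

text \<open>By weakening, a type of a subterm in the short context is also its type in the extended
  one, whose conditions therefore cover it. This brings \<open>mx\<close> from beneath the binders
  of \<open>max_bq\<close> back to the empty context.\<close>

lemma faithful_tm_strengthen:
  "\<Gamma> \<turnstile> t : \<tau> \<Longrightarrow> faithful_tm U (\<Gamma> @ \<Delta>) t \<Longrightarrow> faithful_tm U \<Gamma> t"
proof (induction rule: wt.induct)
  case (wt_Lam \<sigma> \<Gamma> t \<tau>)
  then show ?case using wt_weaken by fastforce
next
  case (wt_Rec \<Gamma> t \<sigma> p q)
  then show ?case using wt_weaken by fastforce
next
  case (wt_App \<Gamma> t \<sigma> \<tau> u)
  then show ?case using wt_weaken by fastforce
qed (auto simp: nth_append)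

lemma faithful_tm_closed: "[] \<turnstile> t : \<tau> \<Longrightarrow> faithful_tm U \<Gamma> t \<Longrightarrow> faithful_tm U [] t"
  using faithful_tm_strengthen[of "[]"] by simp

section \<open>Interpretation\<close>

lemma interp_lift:
  "interp U (lift (length \<gamma>) t) (\<gamma> @ x # \<delta>) = interp U t (\<gamma> @ \<delta>)"
proof (induction t arbitrary: \<gamma>)
  case (Lam \<sigma> t)
  have "interp U (lift (Suc (length \<gamma>)) t) (y # \<gamma> @ x # \<delta>) = interp U t (y # \<gamma> @ \<delta>)" for y
    using Lam[of "y # \<gamma>"] by simp
  then show ?case by simp
next
  case (Var i)
  show ?case by (auto simp: nth_append Suc_diff_le)
qed auto

lemma interp_lift_0 [simp]: "interp U (lift 0 t) (x # \<delta>) = interp U t \<delta>"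
  using interp_lift[of U "[]"] by simp

text \<open>Variables refer only to the first \<open>length \<Gamma>\<close> entries, so the
  environments may differ beyond them; for the empty context this yields
  \<open>interp_closed\<close>.\<close>

lemma interp_cong:
  "\<Gamma> \<turnstile> t : \<tau> \<Longrightarrow> (\<And>i. i < length \<Gamma> \<Longrightarrow> \<gamma> ! i = \<delta> ! i) \<Longrightarrow> interp U t \<gamma> = interp U t \<delta>"
proof (induction arbitrary: \<gamma> \<delta> rule: wt.induct)
  case (wt_Lam \<sigma> \<Gamma> t \<tau>)
  have "interp U t (x # \<gamma>) = interp U t (x # \<delta>)" for x
    by (rule wt_Lam.IH) (auto simp: nth_Cons wt_Lam.prems split: nat.split)
  then show ?case by simp
next
  case (wt_Rec \<Gamma> t \<sigma> p q)
  from wt_Rec.IH[OF wt_Rec.prems] show ?case by simp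
next
  case (wt_App \<Gamma> t \<sigma> \<tau> u)
  from wt_App.IH[OF wt_App.prems] show ?case by simp
next
  case (wt_Succ \<Gamma> t)
  from wt_Succ.IH[OF wt_Succ.prems] show ?case by simp
qed auto

lemma interp_closed: "[] \<turnstile> t : \<tau> \<Longrightarrow> interp U t \<gamma> = interp U t []"
  by (rule interp_cong) auto

section \<open>Environments, application and beta reduction on coded values\<close>

abbreviation env :: "'u coding \<Rightarrow> ty list \<Rightarrow> 'u list \<Rightarrow> bool" where
  "env U \<equiv> list_all2 (\<lambda>\<sigma> x. x \<in> carrier U \<sigma>)"

lemma code_carrier:
  "(\<And>x. x \<in> carrier U \<sigma> \<Longrightarrow> g x \<in> carrier U \<tau>) \<Longrightarrow>
   code U (\<lambda>x\<in>carrier U \<sigma>. g x) \<in> carrier U (\<sigma> \<Rrightarrow> \<tau>)"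
  by auto

lemma ap_code:
  assumes "faithful U (\<sigma> \<Rrightarrow> \<tau>)" and "\<And>x. x \<in> carrier U \<sigma> \<Longrightarrow> g x \<in> carrier U \<tau>"
    and "x \<in> carrier U \<sigma>"
  shows "ap U (code U (\<lambda>x\<in>carrier U \<sigma>. g x)) x = g x"
proof -
  have "(\<lambda>x\<in>carrier U \<sigma>. g x) \<in> carrier U \<sigma> \<rightarrow>\<^sub>E carrier U \<tau>"
    using assms(2) by auto
  then show ?thesis using assms by simp
qed

lemma ap_carrier:
  "faithful U (\<sigma> \<Rrightarrow> \<tau>) \<Longrightarrow> f \<in> carrier U (\<sigma> \<Rrightarrow> \<tau>) \<Longrightarrow> x \<in> carrier U \<sigma> \<Longrightarrow> ap U f x \<in> carrier U \<tau>"
  by (auto dest: PiE_mem)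

text \<open>Elements of the carrier are codes of functions that are \<open>undefined\<close> off the
  domain; agreement on the domain therefore makes these functions, and hence their codes,
  equal.\<close>

lemma carrier_ext:
  assumes "faithful U (\<sigma> \<Rrightarrow> \<tau>)" and "f \<in> carrier U (\<sigma> \<Rrightarrow> \<tau>)" and "g \<in> carrier U (\<sigma> \<Rrightarrow> \<tau>)"
    and "\<And>x. x \<in> carrier U \<sigma> \<Longrightarrow> ap U f x = ap U g x"
  shows "f = g"
proof -
  obtain f' g' where f': "f = code U f'" "f' \<in> carrier U \<sigma> \<rightarrow>\<^sub>E carrier U \<tau>"
    and g': "g = code U g'" "g' \<in> carrier U \<sigma> \<rightarrow>\<^sub>E carrier U \<tau>"
    using assms(2,3) by auto
  with assms(1,4) have "f' = g'" by (intro PiE_ext) auto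
  with f' g' show ?thesis by simp
qed

text \<open>An application, or a step of a recursion, stays in the carrier because decoding is
  correct there; this comes from the faithful type of the function subterm.\<close>

lemma interp_carrier:
  "\<Gamma> \<turnstile> t : \<tau> \<Longrightarrow> faithful_tm U \<Gamma> t \<Longrightarrow> env U \<Gamma> \<gamma> \<Longrightarrow> interp U t \<gamma> \<in> carrier U \<tau>"
proof (induction arbitrary: \<gamma> rule: wt.induct)
  case (wt_Var i \<Gamma> \<sigma>)
  then show ?case by (auto dest: list_all2_nthD)
next
  case (wt_Rec \<Gamma> t \<sigma> p q)
  have t: "interp U t \<gamma> \<in> carrier U (\<iota> \<Rrightarrow> \<sigma> \<Rrightarrow> \<sigma>)"
    and p: "interp U p \<gamma> \<in> carrier U \<sigma>"
    using wt_Rec by simp_all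
  have "faithful U (\<iota> \<Rrightarrow> \<sigma> \<Rrightarrow> \<sigma>)"
    using wt_Rec.hyps wt_Rec.prems by (intro faithful_tm_type[of U \<Gamma> t]) auto
  then have step: "ap U (ap U (interp U t \<gamma>) (num U n)) r \<in> carrier U \<sigma>"
    if "r \<in> carrier U \<sigma>" for n r
    using t that by (intro ap_carrier[of U \<sigma> \<sigma>] ap_carrier[of U \<iota> "\<sigma> \<Rrightarrow> \<sigma>"]) auto
  have "rec_nat (interp U p \<gamma>) (\<lambda>n r. ap U (ap U (interp U t \<gamma>) (num U n)) r) n \<in> carrier U \<sigma>" for n
    by (induction n) (auto intro: p step)
  then show ?case by simp
next
  case (wt_Lam \<sigma> \<Gamma> t \<tau>)
  then show ?case
    unfolding interp.simps by (intro code_carrier) simp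
next
  case (wt_App \<Gamma> t \<sigma> \<tau> u)
  have "faithful U (\<sigma> \<Rrightarrow> \<tau>)"
    using wt_App.hyps wt_App.prems by (intro faithful_tm_type[of U \<Gamma> t]) auto
  then show ?case
    using wt_App ap_carrier[of U \<sigma> \<tau>] by (simp del: carrier.simps(2))
qed auto

lemma interp_beta:
  assumes "\<sigma> # \<Gamma> \<turnstile> t : \<tau>" and "faithful_tm U \<Gamma> (Lam \<sigma> t)" and "env U \<Gamma> \<gamma>" and "x \<in> carrier U \<sigma>"
  shows "ap U (interp U (Lam \<sigma> t) \<gamma>) x = interp U t (x # \<gamma>)"
proof -
  have "faithful U (\<sigma> \<Rrightarrow> \<tau>)"
    using assms(1,2) by (intro faithful_tm_type[of U \<Gamma> "Lam \<sigma> t"]) auto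
  then show ?thesis
    unfolding interp.simps by (rule ap_code) (use assms in \<open>auto intro: interp_carrier\<close>)
qed

text \<open>Arguments are listed from the outermost binder inwards and environments from the
  innermost outwards, hence \<open>rev\<close>. The type is existential because it changes as
  binders are consumed.\<close>

lemma interp_betas:
  assumes "\<exists>\<tau>. \<Gamma> \<turnstile> foldr Lam \<sigma>s t : \<tau>" and "faithful_tm U \<Gamma> (foldr Lam \<sigma>s t)"
    and "env U \<Gamma> \<gamma>" and "env U \<sigma>s xs"
  shows "foldl (ap U) (interp U (foldr Lam \<sigma>s t) \<gamma>) xs = interp U t (rev xs @ \<gamma>)"
  using assms(4,1-3)
proof (induction \<sigma>s xs arbitrary: \<Gamma> \<gamma> rule: list_all2_induct)
  case (Cons \<sigma> \<sigma>s x xs)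
  from Cons.prems obtain \<tau> where "\<sigma> # \<Gamma> \<turnstile> foldr Lam \<sigma>s t : \<tau>" by auto
  with Cons show ?case
    by (simp add: interp_beta del: interp.simps(5))
qed simp

declare carrier.simps(2) [simp del] faithful.simps(2) [simp del]

lemma faithful_arrD: "faithful U (\<sigma> \<Rrightarrow> \<tau>) \<Longrightarrow> faithful U \<sigma> \<and> faithful U \<tau>"
  by (simp add: faithful.simps)

section \<open>External dialogue trees\<close>

datatype dtree = Leaf nat | Query "nat \<Rightarrow> dtree" nat

primrec dialogue :: "dtree \<Rightarrow> (nat \<Rightarrow> nat) \<Rightarrow> nat" where
  "dialogue (Leaf n) = (\<lambda>\<alpha>. n)"
| "dialogue (Query \<phi> i) = (\<lambda>\<alpha>. dialogue (\<phi> (\<alpha> i)) \<alpha>)"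

primrec bind :: "dtree \<Rightarrow> (nat \<Rightarrow> dtree) \<Rightarrow> dtree" where
  "bind (Leaf n) F = F n"
| "bind (Query \<phi> i) F = Query (\<lambda>k. bind (\<phi> k) F) i"

lemma dialogue_bind: "dialogue (bind T F) \<alpha> = dialogue (F (dialogue T \<alpha>)) \<alpha>"
  by (induction T) auto

text \<open>Only the branches for the answers 0 and 1 are searched, as
  \<open>embed_bool \<alpha>\<close> gives no others; over all of \<nat> there need not be a largest
  query. The value 0 at a leaf is a default.\<close>

primrec max_query :: "dtree \<Rightarrow> nat" where
  "max_query (Leaf n) = 0"
| "max_query (Query \<phi> i) = max i (max (max_query (\<phi> 0)) (max_query (\<phi> 1)))"

text \<open>The query at the root is at most \<open>max_query T\<close>, so both sequences answer it
  alike and descend to the same subtree, whose own bound is no larger.\<close>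

lemma dialogue_embed_bool_cong:
  "(\<And>i. i \<le> max_query T \<Longrightarrow> \<alpha> i = \<beta> i) \<Longrightarrow>
   dialogue T (embed_bool \<alpha>) = dialogue T (embed_bool \<beta>)"
proof (induction T)
  case (Query \<phi> i)
  have "\<alpha> i = \<beta> i" using Query.prems by simp
  moreover have "dialogue (\<phi> k) (embed_bool \<alpha>) = dialogue (\<phi> k) (embed_bool \<beta>)" if "k = 0 \<or> k = 1" for k
    using that by (intro Query.IH Query.prems) auto
  \<comment> \<open>The definition is unfolded at \<open>i\<close> alone, so that the sequences
    handed to the subtree keep the form of the previous fact.\<close>
  ultimately show ?case by (cases "\<alpha> i") (auto simp: embed_bool_def[of _ i])
qed simp

section \<open>Church encodings of external trees\<close>

primrec fold_tree :: "'u coding \<Rightarrow> 'u \<Rightarrow> 'u \<Rightarrow> dtree \<Rightarrow> 'u" where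
  "fold_tree U e b (Leaf n) = ap U e (num U n)"
| "fold_tree U e b (Query \<phi> i) =
     ap U (ap U b (code U (\<lambda>y\<in>carrier U \<iota>. fold_tree U e b (\<phi> (nat_of U y))))) (num U i)"

text \<open>The semantic Church encoding: the fold of \<open>T\<close> as a function of its leaf
  operation \<open>e\<close> and its query operation \<open>b\<close>, with answer type
  \<iota>.\<close>

definition enc :: "'u coding \<Rightarrow> dtree \<Rightarrow> 'u" where
  "enc U T = code U (\<lambda>e\<in>carrier U (\<iota> \<Rrightarrow> \<iota>).
     code U (\<lambda>b\<in>carrier U ((\<iota> \<Rrightarrow> \<iota>) \<Rrightarrow> \<iota> \<Rrightarrow> \<iota>). fold_tree U e b T))"

locale num_coding =
  fixes U :: "'u coding"
  assumes inj_num: "inj (num U)"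
begin

lemma nat_of_num [simp]: "nat_of U (num U n) = n"
  unfolding nat_of_def using inj_num by simp

lemma fold_tree_carrier:
  assumes "faithful U (ChD \<iota> \<iota>)"
    and "e \<in> carrier U (\<iota> \<Rrightarrow> \<iota>)" and "b \<in> carrier U ((\<iota> \<Rrightarrow> \<iota>) \<Rrightarrow> \<iota> \<Rrightarrow> \<iota>)"
  shows "fold_tree U e b T \<in> carrier U \<iota>"
proof (induction T)
  case (Leaf n)
  have "faithful U (\<iota> \<Rrightarrow> \<iota>)" using assms(1) by (auto simp: ChD_def dest!: faithful_arrD)
  then show ?case using assms(2) ap_carrier[of U \<iota> \<iota>] by simp
next
  case (Query \<phi> i)
  have "faithful U (\<iota> \<Rrightarrow> \<iota>)" "faithful U ((\<iota> \<Rrightarrow> \<iota>) \<Rrightarrow> \<iota> \<Rrightarrow> \<iota>)"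
    using assms(1) by (simp_all add: ChD_def) (auto dest!: faithful_arrD)
  then show ?case
    unfolding fold_tree.simps using assms(3) Query.IH
    by (intro ap_carrier[of U \<iota> \<iota>] ap_carrier[of U "\<iota> \<Rrightarrow> \<iota>" "\<iota> \<Rrightarrow> \<iota>"] code_carrier) auto
qed

lemma enc_carrier: "faithful U (ChD \<iota> \<iota>) \<Longrightarrow> enc U T \<in> carrier U (ChD \<iota> \<iota>)"
  unfolding enc_def ChD_def
  by (intro code_carrier fold_tree_carrier) (auto simp: ChD_def)

lemma ap_enc:
  assumes "faithful U (ChD \<iota> \<iota>)"
    and "e \<in> carrier U (\<iota> \<Rrightarrow> \<iota>)" and "b \<in> carrier U ((\<iota> \<Rrightarrow> \<iota>) \<Rrightarrow> \<iota> \<Rrightarrow> \<iota>)"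
  shows "ap U (ap U (enc U T) e) b = fold_tree U e b T"
proof -
  have F: "faithful U (((\<iota> \<Rrightarrow> \<iota>) \<Rrightarrow> \<iota> \<Rrightarrow> \<iota>) \<Rrightarrow> \<iota>)"
    using assms(1) by (auto simp: ChD_def dest!: faithful_arrD)
  have "ap U (enc U T) e = code U (\<lambda>b\<in>carrier U ((\<iota> \<Rrightarrow> \<iota>) \<Rrightarrow> \<iota> \<Rrightarrow> \<iota>). fold_tree U e b T)"
    unfolding enc_def using assms
    by (intro ap_code[where \<tau> = "((\<iota> \<Rrightarrow> \<iota>) \<Rrightarrow> \<iota> \<Rrightarrow> \<iota>) \<Rrightarrow> \<iota>"] code_carrier fold_tree_carrier)
      (auto simp: ChD_def)
  also have "ap U \<dots> b = fold_tree U e b T"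
    using assms F by (intro ap_code[where \<tau> = \<iota>] fold_tree_carrier) auto
  finally show ?thesis .
qed

text \<open>Extensionality in the arguments \<open>e\<close> and \<open>b\<close>. The values of
  \<open>eta\<close>, \<open>beta\<close> and \<open>kleisli\<close> are identified with encoded
  trees in this way, by comparing folds.\<close>

lemma eq_encI:
  assumes F: "faithful U (ChD \<iota> \<iota>)" and d: "d \<in> carrier U (ChD \<iota> \<iota>)"
    and eq: "\<And>e b. e \<in> carrier U (\<iota> \<Rrightarrow> \<iota>) \<Longrightarrow> b \<in> carrier U ((\<iota> \<Rrightarrow> \<iota>) \<Rrightarrow> \<iota> \<Rrightarrow> \<iota>) \<Longrightarrow>
      ap U (ap U d e) b = fold_tree U e b T"
  shows "d = enc U T"
proof (rule carrier_ext[OF F[unfolded ChD_def] d[unfolded ChD_def] enc_carrier[OF F, unfolded ChD_def]])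
  fix e assume e: "e \<in> carrier U (\<iota> \<Rrightarrow> \<iota>)"
  have F': "faithful U (((\<iota> \<Rrightarrow> \<iota>) \<Rrightarrow> \<iota> \<Rrightarrow> \<iota>) \<Rrightarrow> \<iota>)"
    using F by (auto simp: ChD_def dest!: faithful_arrD)
  note c = ap_carrier[OF F[unfolded ChD_def] _ e]
  show "ap U d e = ap U (enc U T) e"
    by (rule carrier_ext[OF F' c[OF d[unfolded ChD_def]] c[OF enc_carrier[OF F, unfolded ChD_def]]])
      (simp add: eq e ap_enc F)
qed

section \<open>Interpretation of the combinators\<close>

lemma ap_eta:
  assumes "faithful_tm U \<Gamma> (eta \<iota> \<iota>)" and "env U \<Gamma> \<gamma>"
  shows "ap U (interp U (eta \<iota> \<iota>) \<gamma>) (num U n) = enc U (Leaf n)"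
proof (rule eq_encI)
  have "faithful U (\<iota> \<Rrightarrow> ChD \<iota> \<iota>)" using assms(1) by (rule faithful_tm_type) simp
  then show "faithful U (ChD \<iota> \<iota>)" by (auto dest: faithful_arrD)
  show "ap U (interp U (eta \<iota> \<iota>) \<gamma>) (num U n) \<in> carrier U (ChD \<iota> \<iota>)"
    using \<open>faithful U (\<iota> \<Rrightarrow> ChD \<iota> \<iota>)\<close> by (rule ap_carrier) (auto intro: interp_carrier assms)
next
  fix e b assume "e \<in> carrier U (\<iota> \<Rrightarrow> \<iota>)" "b \<in> carrier U ((\<iota> \<Rrightarrow> \<iota>) \<Rrightarrow> \<iota> \<Rrightarrow> \<iota>)"
  then show "ap U (ap U (ap U (interp U (eta \<iota> \<iota>) \<gamma>) (num U n)) e) b = fold_tree U e b (Leaf n)"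
    using interp_betas[of \<Gamma> "[\<iota>, \<iota> \<Rrightarrow> \<iota>, (\<iota> \<Rrightarrow> \<iota>) \<Rrightarrow> \<iota> \<Rrightarrow> \<iota>]" "Var 1 \<cdot> Var 2" U \<gamma> "[num U n, e, b]"] assms
    unfolding eta_def by (simp del: interp.simps(5))
qed

lemma ap_beta:
  assumes "faithful_tm U \<Gamma> (beta \<iota> \<iota>)" and "env U \<Gamma> \<gamma>"
    and "f \<in> carrier U (\<iota> \<Rrightarrow> ChD \<iota> \<iota>)" and f: "\<And>n. ap U f (num U n) = enc U (\<phi> n)"
  shows "ap U (ap U (interp U (beta \<iota> \<iota>) \<gamma>) f) (num U i) = enc U (Query \<phi> i)"
proof (rule eq_encI)
  have F: "faithful U ((\<iota> \<Rrightarrow> ChD \<iota> \<iota>) \<Rrightarrow> \<iota> \<Rrightarrow> ChD \<iota> \<iota>)"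
    using assms(1) by (rule faithful_tm_type) simp
  then have F': "faithful U (\<iota> \<Rrightarrow> ChD \<iota> \<iota>)" by (auto dest: faithful_arrD)
  then show *: "faithful U (ChD \<iota> \<iota>)" by (auto dest: faithful_arrD)
  show "ap U (ap U (interp U (beta \<iota> \<iota>) \<gamma>) f) (num U i) \<in> carrier U (ChD \<iota> \<iota>)"
    by (rule ap_carrier[OF F' ap_carrier[OF F]]) (auto intro: interp_carrier assms)
  fix e b assume eb: "e \<in> carrier U (\<iota> \<Rrightarrow> \<iota>)" "b \<in> carrier U ((\<iota> \<Rrightarrow> \<iota>) \<Rrightarrow> \<iota> \<Rrightarrow> \<iota>)"
  let ?t = "Lam \<iota> (Var 4 \<cdot> Var 0 \<cdot> Var 2 \<cdot> Var 1)"
  have "ap U (ap U (ap U (ap U (interp U (beta \<iota> \<iota>) \<gamma>) f) (num U i)) e) b =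
      ap U (ap U b (interp U ?t (b # e # num U i # f # \<gamma>))) (num U i)"
    using interp_betas[of \<Gamma> "[\<iota> \<Rrightarrow> ChD \<iota> \<iota>, \<iota>, \<iota> \<Rrightarrow> \<iota>, (\<iota> \<Rrightarrow> \<iota>) \<Rrightarrow> \<iota> \<Rrightarrow> \<iota>]"
      "Var 0 \<cdot> ?t \<cdot> Var 2" U \<gamma> "[f, num U i, e, b]"] assms(1-3) eb
    unfolding beta_def by (simp add: ChD_def del: interp.simps(5))
  \<comment> \<open>Since \<open>ap U f\<close> at the numeral \<open>n\<close> encodes
    \<open>\<phi> n\<close>, the body of this abstraction is a fold of \<open>\<phi> n\<close>; the
    whole is the code that \<open>fold_tree\<close> passes to \<open>b\<close> at a query.\<close>
  also have "interp U ?t (b # e # num U i # f # \<gamma>) =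
      code U (\<lambda>y\<in>carrier U \<iota>. fold_tree U e b (\<phi> (nat_of U y)))"
    using eb by (auto intro!: arg_cong[where f = "code U"] simp: fun_eq_iff restrict_def f ap_enc *)
  finally show "ap U (ap U (ap U (ap U (interp U (beta \<iota> \<iota>) \<gamma>) f) (num U i)) e) b =
      fold_tree U e b (Query \<phi> i)" by simp
qed

lemma ap_kleisli:
  assumes "faithful_tm U \<Gamma> (kleisli \<iota> \<iota> \<iota>)" and "env U \<Gamma> \<gamma>"
    and "f \<in> carrier U (\<iota> \<Rrightarrow> ChD \<iota> \<iota>)" and f: "\<And>n. ap U f (num U n) = enc U (F n)"
  shows "ap U (ap U (interp U (kleisli \<iota> \<iota> \<iota>) \<gamma>) f) (enc U T) = enc U (bind T F)"
proof (rule eq_encI)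
  have K: "faithful U ((\<iota> \<Rrightarrow> ChD \<iota> \<iota>) \<Rrightarrow> ChD \<iota> \<iota> \<Rrightarrow> ChD \<iota> \<iota>)"
    using assms(1) by (rule faithful_tm_type) simp
  then have K': "faithful U (ChD \<iota> \<iota> \<Rrightarrow> ChD \<iota> \<iota>)" by (auto dest: faithful_arrD)
  then show *: "faithful U (ChD \<iota> \<iota>)" by (auto dest: faithful_arrD)
  then have F1: "faithful U (\<iota> \<Rrightarrow> \<iota>)" by (auto simp: ChD_def dest!: faithful_arrD)
  show "ap U (ap U (interp U (kleisli \<iota> \<iota> \<iota>) \<gamma>) f) (enc U T) \<in> carrier U (ChD \<iota> \<iota>)"
    by (rule ap_carrier[OF K' ap_carrier[OF K]]) (auto intro: interp_carrier assms enc_carrier *)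
  fix e b assume eb: "e \<in> carrier U (\<iota> \<Rrightarrow> \<iota>)" "b \<in> carrier U ((\<iota> \<Rrightarrow> \<iota>) \<Rrightarrow> \<iota> \<Rrightarrow> \<iota>)"
  let ?t = "Lam \<iota> (Var 4 \<cdot> Var 0 \<cdot> Var 2 \<cdot> Var 1)"
  \<comment> \<open>The leaf operation that continues with the fold of \<open>F n\<close> at a leaf
    \<open>n\<close>; it will turn out to be the value of the inner abstraction
    \<open>?t\<close>.\<close>
  let ?e = "code U (\<lambda>y\<in>carrier U \<iota>. fold_tree U e b (F (nat_of U y)))"
  have e: "?e \<in> carrier U (\<iota> \<Rrightarrow> \<iota>)"
    using eb by (intro code_carrier fold_tree_carrier *)
  have "ap U (ap U (ap U (ap U (interp U (kleisli \<iota> \<iota> \<iota>) \<gamma>) f) (enc U T)) e) b =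
      ap U (ap U (enc U T) (interp U ?t (b # e # enc U T # f # \<gamma>))) b"
    using interp_betas[of \<Gamma> "[\<iota> \<Rrightarrow> ChD \<iota> \<iota>, ChD \<iota> \<iota>, \<iota> \<Rrightarrow> \<iota>, (\<iota> \<Rrightarrow> \<iota>) \<Rrightarrow> \<iota> \<Rrightarrow> \<iota>]"
      "Var 2 \<cdot> ?t \<cdot> Var 0" U \<gamma> "[f, enc U T, e, b]"] assms(1-3) eb enc_carrier[OF *]
    unfolding kleisli_def by (simp add: ChD_def del: interp.simps(5))
  also have "interp U ?t (b # e # enc U T # f # \<gamma>) = ?e"
    using eb by (auto intro!: arg_cong[where f = "code U"] simp: fun_eq_iff restrict_def f ap_enc *)
  also have "ap U (ap U (enc U T) ?e) b = fold_tree U ?e b T"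
    by (intro ap_enc * e eb)
  \<comment> \<open>Fusion: folding with \<open>?e\<close> amounts to substituting the trees
    \<open>F n\<close> for the leaves and folding afterwards. At a query both folds have the same
    form.\<close>
  also have "\<dots> = fold_tree U e b (bind T F)"
  proof (induction T)
    case (Leaf n)
    have "ap U ?e (num U n) = fold_tree U e b (F (nat_of U (num U n)))"
      using eb by (intro ap_code[OF F1] fold_tree_carrier *) auto
    then show ?case by (simp only: fold_tree.simps bind.simps nat_of_num)
  qed simp
  finally show "ap U (ap U (ap U (ap U (interp U (kleisli \<iota> \<iota> \<iota>) \<gamma>) f) (enc U T)) e) b =
      fold_tree U e b (bind T F)" .
qed

lemma ap_map_tm:
  assumes "faithful_tm U \<Gamma> (map_tm \<iota> \<iota> \<iota>)" and "env U \<Gamma> \<gamma>"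
    and "f \<in> carrier U (\<iota> \<Rrightarrow> \<iota>)" and f: "\<And>n. ap U f (num U n) = num U (g n)"
  shows "ap U (ap U (interp U (map_tm \<iota> \<iota> \<iota>) \<gamma>) f) (enc U T) = enc U (bind T (\<lambda>n. Leaf (g n)))"
proof -
  let ?t = "Lam \<iota> (eta \<iota> \<iota> \<cdot> (Var 1 \<cdot> Var 0))" and ?\<Gamma> = "(\<iota> \<Rrightarrow> \<iota>) # \<Gamma>"
  have t: "faithful_tm U ?\<Gamma> ?t" "faithful_tm U ?\<Gamma> (kleisli \<iota> \<iota> \<iota>)"
    and env: "env U ?\<Gamma> (f # \<gamma>)"
    using assms(1-3) by (auto simp: map_tm_def)
  have "ap U (interp U (map_tm \<iota> \<iota> \<iota>) \<gamma>) f =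
      ap U (interp U (kleisli \<iota> \<iota> \<iota>) (f # \<gamma>)) (interp U ?t (f # \<gamma>))"
    using assms(1-3) interp_beta[of "\<iota> \<Rrightarrow> \<iota>" \<Gamma> "kleisli \<iota> \<iota> \<iota> \<cdot> ?t" "ChD \<iota> \<iota> \<Rrightarrow> ChD \<iota> \<iota>" U \<gamma> f]
    unfolding map_tm_def by (simp del: interp.simps(5))
  moreover have "ap U (interp U ?t (f # \<gamma>)) (num U n) = enc U (Leaf (g n))" for n
    using t(1) env
      interp_beta[of \<iota> ?\<Gamma> "eta \<iota> \<iota> \<cdot> (Var 1 \<cdot> Var 0)" "ChD \<iota> \<iota>" U "f # \<gamma>" "num U n"]
    by (simp add: f ap_eta[of "\<iota> # ?\<Gamma>"] del: interp.simps(5))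
  moreover have "interp U ?t (f # \<gamma>) \<in> carrier U (\<iota> \<Rrightarrow> ChD \<iota> \<iota>)"
    using t(1) env by (intro interp_carrier[of ?\<Gamma>]) auto
  ultimately show ?thesis
    using ap_kleisli[OF t(2) env] by simp
qed

text \<open>Each leaf \<open>n\<close> becomes the query at \<open>n\<close> whose answer is
  returned as a leaf. The new tree thus computes
  \<open>\<alpha> (dialogue T \<alpha>)\<close>.\<close>

lemma ap_generic:
  assumes "faithful_tm U \<Gamma> (generic \<iota>)" and "env U \<Gamma> \<gamma>"
  shows "ap U (interp U (generic \<iota>) \<gamma>) (enc U T) = enc U (bind T (Query Leaf))"
proof -
  let ?t = "Lam \<iota> (beta \<iota> \<iota> \<cdot> eta \<iota> \<iota> \<cdot> Var 0)"
  have t: "faithful_tm U \<Gamma> ?t" "faithful_tm U \<Gamma> (kleisli \<iota> \<iota> \<iota>)"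
    using assms by (auto simp: generic_def)
  have "ap U (interp U ?t \<gamma>) (num U n) = enc U (Query Leaf n)" for n
  proof -
    have env: "env U (\<iota> # \<Gamma>) (num U n # \<gamma>)" using assms(2) by simp
    have "interp U (eta \<iota> \<iota>) (num U n # \<gamma>) \<in> carrier U (\<iota> \<Rrightarrow> ChD \<iota> \<iota>)"
      using t(1) env by (intro interp_carrier[of "\<iota> # \<Gamma>"]) auto
    then show ?thesis
      using t(1) assms(2) env
        interp_beta[of \<iota> \<Gamma> "beta \<iota> \<iota> \<cdot> eta \<iota> \<iota> \<cdot> Var 0" "ChD \<iota> \<iota>" U \<gamma> "num U n"]
      by (simp add: ap_beta[of "\<iota> # \<Gamma>"] ap_eta[of "\<iota> # \<Gamma>"] del: interp.simps(5))
  qed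
  moreover have "interp U ?t \<gamma> \<in> carrier U (\<iota> \<Rrightarrow> ChD \<iota> \<iota>)"
    using t(1) assms(2) by (intro interp_carrier) auto
  ultimately show ?thesis
    using ap_kleisli[OF t(2) assms(2)] by (simp add: generic_def)
qed

end

section \<open>The logical relation\<close>

text \<open>The function clause includes membership in the carriers because beta reduction on codes
  is available only there; at \<iota> membership follows from the tree.\<close>

primrec LR :: "'u coding \<Rightarrow> ty \<Rightarrow> ((nat \<Rightarrow> nat) \<Rightarrow> 'u) \<Rightarrow> 'u \<Rightarrow> bool" where
  "LR U \<iota> = (\<lambda>x d. \<exists>T. (\<forall>\<alpha>. x \<alpha> = num U (dialogue T \<alpha>)) \<and> d = enc U T)"
| "LR U (\<sigma> \<Rrightarrow> \<tau>) = (\<lambda>f g. (\<forall>\<alpha>. f \<alpha> \<in> carrier U (\<sigma> \<Rrightarrow> \<tau>)) \<and> g \<in> carrier U (trans_ty \<iota> (\<sigma> \<Rrightarrow> \<tau>)) \<and>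
     (\<forall>x d. LR U \<sigma> x d \<longrightarrow> LR U \<tau> (\<lambda>\<alpha>. ap U (f \<alpha>) (x \<alpha>)) (ap U g d)))"

lemma LR_app: "LR U (\<sigma> \<Rrightarrow> \<tau>) f g \<Longrightarrow> LR U \<sigma> x d \<Longrightarrow> LR U \<tau> (\<lambda>\<alpha>. ap U (f \<alpha>) (x \<alpha>)) (ap U g d)"
  by simp

text \<open>Faithfulness at this type puts \<open>enc U T\<close> into its carrier. In the theorem
  it is available because the dialogue tree of \<open>t\<close> has this type.\<close>

locale dialogue_coding = num_coding +
  assumes faithful_ChD: "faithful U (ChD \<iota> \<iota>)"
begin

lemma LR_carrier:
  assumes "LR U \<sigma> x d"
  shows "x \<alpha> \<in> carrier U \<sigma>" and "d \<in> carrier U (trans_ty \<iota> \<sigma>)"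
  using assms by (cases \<sigma>; auto intro: enc_carrier faithful_ChD)+

text \<open>This handles a recursion whose length depends on \<alpha>: \<open>T\<close> computes an
  index, and the extension selects the related family at that index. At \<iota> it is
  \<open>bind\<close>; at function types the argument is first moved inside.\<close>

lemma LR_ext_tm:
  assumes "faithful_tm U \<Gamma> (ext_tm \<iota> \<sigma>)" and "env U \<Gamma> \<gamma>"
    and "f \<in> carrier U (\<iota> \<Rrightarrow> trans_ty \<iota> \<sigma>)" and "\<And>n. LR U \<sigma> (x n) (ap U f (num U n))"
  shows "LR U \<sigma> (\<lambda>\<alpha>. x (dialogue T \<alpha>) \<alpha>) (ap U (ap U (interp U (ext_tm \<iota> \<sigma>) \<gamma>) f) (enc U T))"
  using assms
proof (induction \<sigma> arbitrary: \<Gamma> \<gamma> f x)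
  case Iota
  from Iota.prems(4) obtain F where
    "\<And>n \<alpha>. x n \<alpha> = num U (dialogue (F n) \<alpha>)" "\<And>n. ap U f (num U n) = enc U (F n)"
    by simp metis
  with Iota.prems(1-3) show ?case
    by (auto simp: ap_kleisli dialogue_bind intro!: exI[of _ "bind T F"])
next
  case (Arr \<sigma> \<tau>)
  let ?e = "interp U (ext_tm \<iota> (\<sigma> \<Rrightarrow> \<tau>)) \<gamma>"
  have F: "faithful U ((\<iota> \<Rrightarrow> trans_ty \<iota> (\<sigma> \<Rrightarrow> \<tau>)) \<Rrightarrow> ChD \<iota> \<iota> \<Rrightarrow> trans_ty \<iota> (\<sigma> \<Rrightarrow> \<tau>))"
    using Arr.prems(1) by (rule faithful_tm_type) (simp only: wt_ext_tm)
  have "?e \<in> carrier U ((\<iota> \<Rrightarrow> trans_ty \<iota> (\<sigma> \<Rrightarrow> \<tau>)) \<Rrightarrow> ChD \<iota> \<iota> \<Rrightarrow> trans_ty \<iota> (\<sigma> \<Rrightarrow> \<tau>))"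
    using Arr.prems(1,2) by (intro interp_carrier) (simp_all only: wt_ext_tm)
  with F have "ap U (ap U ?e f) (enc U T) \<in> carrier U (trans_ty \<iota> (\<sigma> \<Rrightarrow> \<tau>))"
    using Arr.prems(3) enc_carrier[OF faithful_ChD] by (blast intro: ap_carrier dest: faithful_arrD)
  moreover have "LR U \<tau> (\<lambda>\<alpha>. ap U (x (dialogue T \<alpha>) \<alpha>) (y \<alpha>)) (ap U (ap U (ap U ?e f) (enc U T)) d)"
    if y: "LR U \<sigma> y d" for y d
  proof -
    let ?t = "Lam \<iota> (Var 3 \<cdot> Var 0 \<cdot> Var 1)" and ?\<gamma> = "d # enc U T # f # \<gamma>"
    let ?\<Gamma> = "trans_ty \<iota> \<sigma> # ChD \<iota> \<iota> # (\<iota> \<Rrightarrow> trans_ty \<iota> (\<sigma> \<Rrightarrow> \<tau>)) # \<Gamma>"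
    have env: "env U ?\<Gamma> ?\<gamma>"
      using Arr.prems(2,3) LR_carrier(2)[OF y] enc_carrier[OF faithful_ChD] by simp
    have t: "faithful_tm U ?\<Gamma> ?t" "faithful_tm U ?\<Gamma> (ext_tm \<iota> \<tau>)"
      using Arr.prems(1) by simp_all
    \<comment> \<open>After three beta steps the extension at \<open>\<tau>\<close> acts on the
      function \<open>\<lambda>x. f x d\<close>, so the induction hypothesis applies to the families
      already applied to \<open>y\<close>.\<close>
    have "ap U (ap U (ap U ?e f) (enc U T)) d =
        ap U (ap U (interp U (ext_tm \<iota> \<tau>) ?\<gamma>) (interp U ?t ?\<gamma>)) (enc U T)"
      using interp_betas[of \<Gamma> "[\<iota> \<Rrightarrow> trans_ty \<iota> (\<sigma> \<Rrightarrow> \<tau>), ChD \<iota> \<iota>, trans_ty \<iota> \<sigma>]"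
        "ext_tm \<iota> \<tau> \<cdot> ?t \<cdot> Var 1" U \<gamma> "[f, enc U T, d]"] Arr.prems(1-2) env
      by (simp del: interp.simps(5))
    moreover have "ap U (interp U ?t ?\<gamma>) (num U n) = ap U (ap U f (num U n)) d" for n
      using t env
        interp_beta[of \<iota> ?\<Gamma> "Var 3 \<cdot> Var 0 \<cdot> Var 1" "trans_ty \<iota> \<tau>" U ?\<gamma> "num U n"]
      by (simp del: interp.simps(5))
    moreover have "interp U ?t ?\<gamma> \<in> carrier U (\<iota> \<Rrightarrow> trans_ty \<iota> \<tau>)"
      using t env by (intro interp_carrier[of ?\<Gamma>]) auto
    ultimately show ?thesis
      using Arr.IH(2)[OF t(2) env, of "interp U ?t ?\<gamma>" "\<lambda>n \<alpha>. ap U (x n \<alpha>) (y \<alpha>)"]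
        LR_app[OF Arr.prems(4) y] by simp
  qed
  ultimately show ?case
    using Arr.prems(4) by (simp del: ext_tm.simps)
qed

abbreviation LR_env :: "ty list \<Rightarrow> (((nat \<Rightarrow> nat) \<Rightarrow> 'a) \<times> 'a) list \<Rightarrow> bool" where
  "LR_env \<equiv> list_all2 (\<lambda>\<sigma> p. LR U \<sigma> (fst p) (snd p))"

lemma LR_env_env:
  assumes "LR_env \<Gamma> \<epsilon>"
  shows "env U \<Gamma> (map (\<lambda>p. fst p \<alpha>) \<epsilon>)" and "env U (map (trans_ty \<iota>) \<Gamma>) (map snd \<epsilon>)"
  using assms by (auto simp: list_all2_conv_all_nth dest: LR_carrier)

text \<open>The fundamental lemma, by induction on typing. Faithfulness is assumed for both
  \<open>t\<close> and its translation, since beta rules for codes evaluate each of them.\<close>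

lemma LR_interp:
  assumes "\<Gamma> \<turnstile> t : \<tau>" and "faithful_tm U \<Gamma> t"
    and "faithful_tm U (map (trans_ty \<iota>) \<Gamma>) (trans_tm \<iota> t)" and "LR_env \<Gamma> \<epsilon>"
  shows "LR U \<tau> (\<lambda>\<alpha>. interp U t (map (\<lambda>p. fst p \<alpha>) \<epsilon>)) (interp U (trans_tm \<iota> t) (map snd \<epsilon>))"
  using assms
proof (induction arbitrary: \<epsilon> rule: wt.induct)
  case (wt_Var i \<Gamma> \<sigma>)
  then show ?case by (auto simp: list_all2_conv_all_nth)
next
  case (wt_Zero \<Gamma>)
  then show ?case
    using ap_eta[OF _ LR_env_env(2)[OF wt_Zero(3)]] by (auto intro: exI[of _ "Leaf 0"])
next
  case (wt_Succ \<Gamma> t)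
  let ?\<Gamma> = "map (trans_ty \<iota>) \<Gamma>" and ?\<gamma> = "map snd \<epsilon>"
  note env = LR_env_env(2)[OF wt_Succ.prems(3)]
  have "LR U \<iota> (\<lambda>\<alpha>. interp U t (map (\<lambda>p. fst p \<alpha>) \<epsilon>)) (interp U (trans_tm \<iota> t) ?\<gamma>)"
    using wt_Succ.prems by (intro wt_Succ.IH) simp_all
  then obtain T where T: "\<And>\<alpha>. interp U t (map (\<lambda>p. fst p \<alpha>) \<epsilon>) = num U (dialogue T \<alpha>)"
    "interp U (trans_tm \<iota> t) ?\<gamma> = enc U T"
    by auto
  have s: "interp U (Lam \<iota> (Succ (Var 0))) ?\<gamma> \<in> carrier U (\<iota> \<Rrightarrow> \<iota>)"
    using wt_Succ.prems(2) env by (intro interp_carrier) auto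
  have "ap U (interp U (Lam \<iota> (Succ (Var 0))) ?\<gamma>) (num U n) = num U (Suc n)" for n
    using wt_Succ.prems(2) env interp_beta[of \<iota> ?\<Gamma> "Succ (Var 0)" \<iota> U ?\<gamma> "num U n"]
    by (simp del: interp.simps(5))
  from ap_map_tm[OF _ env s this] wt_Succ.prems(2) T show ?case
    by (auto simp: dialogue_bind simp del: interp.simps(5) intro!: exI[of _ "bind T (\<lambda>n. Leaf (Suc n))"])
next
  case (wt_Rec \<Gamma> t \<sigma> p q)
  let ?\<Gamma> = "map (trans_ty \<iota>) \<Gamma>" and ?\<gamma> = "map snd \<epsilon>" and ?\<gamma>' = "\<lambda>\<alpha>. map (\<lambda>p. fst p \<alpha>) \<epsilon>"
  note env = LR_env_env(2)[OF wt_Rec.prems(3)]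
  let ?s = "Lam \<iota> (lift 0 (lift 0 (trans_tm \<iota> t)) \<cdot> (eta \<iota> \<iota> \<cdot> Var 0))"
  let ?R = "Rec (trans_ty \<iota> \<sigma>) ?s (lift 0 (trans_tm \<iota> p)) (Var 0)"
  have typed: "?\<Gamma> \<turnstile> trans_tm \<iota> t : ChD \<iota> \<iota> \<Rrightarrow> trans_ty \<iota> \<sigma> \<Rrightarrow> trans_ty \<iota> \<sigma>"
    "?\<Gamma> \<turnstile> trans_tm \<iota> p : trans_ty \<iota> \<sigma>"
    using wt_Rec.hyps[THEN wt_trans_tm[of _ _ _ \<iota>]] by simp_all
  from wt_Rec.prems(2) have ok: "faithful_tm U ?\<Gamma> (Lam \<iota> ?R)" "faithful_tm U (\<iota> # ?\<Gamma>) ?s"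
    "faithful_tm U (\<iota> # \<iota> # ?\<Gamma>) (eta \<iota> \<iota>)" "faithful_tm U ?\<Gamma> (ext_tm \<iota> \<sigma>)"
    by (simp_all del: wt_simps)
  \<comment> \<open>The family of values after \<open>n\<close> steps, with \<open>n\<close>
    independent of \<alpha>; the actual number of steps enters through \<open>T\<close> at the
    end.\<close>
  let ?x = "\<lambda>n \<alpha>. rec_nat (interp U p (?\<gamma>' \<alpha>)) (\<lambda>n r. ap U (ap U (interp U t (?\<gamma>' \<alpha>)) (num U n)) r) n"
  have "LR U \<iota> (\<lambda>\<alpha>. interp U q (?\<gamma>' \<alpha>)) (interp U (trans_tm \<iota> q) ?\<gamma>)"
    using wt_Rec.prems by (intro wt_Rec.IH) (simp_all del: wt_simps)
  then obtain T where T: "\<And>\<alpha>. interp U q (?\<gamma>' \<alpha>) = num U (dialogue T \<alpha>)"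
    "interp U (trans_tm \<iota> q) ?\<gamma> = enc U T"
    by auto
  have t: "LR U (\<iota> \<Rrightarrow> \<sigma> \<Rrightarrow> \<sigma>) (\<lambda>\<alpha>. interp U t (?\<gamma>' \<alpha>)) (interp U (trans_tm \<iota> t) ?\<gamma>)"
    and p: "LR U \<sigma> (\<lambda>\<alpha>. interp U p (?\<gamma>' \<alpha>)) (interp U (trans_tm \<iota> p) ?\<gamma>)"
    using wt_Rec.prems by (intro wt_Rec.IH; simp del: wt_simps)+
  \<comment> \<open>The two lifts discard the entries \<open>k\<close> and \<open>n\<close>, leaving
    the translated step term applied to the encoded leaf \<open>k\<close>.\<close>
  have s: "ap U (interp U ?s (num U n # ?\<gamma>)) (num U k) = ap U (interp U (trans_tm \<iota> t) ?\<gamma>) (enc U (Leaf k))"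
    for n k
    using interp_beta[of \<iota> "\<iota> # ?\<Gamma>" "lift 0 (lift 0 (trans_tm \<iota> t)) \<cdot> (eta \<iota> \<iota> \<cdot> Var 0)"
        "trans_ty \<iota> \<sigma> \<Rrightarrow> trans_ty \<iota> \<sigma>" U "num U n # ?\<gamma>" "num U k"]
      ok(2) typed env ap_eta[OF ok(3), of "num U k # num U n # ?\<gamma>"]
    by (simp del: interp.simps(5) faithful_tm_simps)
  \<comment> \<open>The entry \<open>n\<close> of the environment stays fixed while the recursion
    counter \<open>k\<close> grows; the instance \<open>k = n\<close> is the one used.\<close>
  have step: "LR U \<sigma> (?x k) (rec_nat (interp U (trans_tm \<iota> p) ?\<gamma>)
      (\<lambda>k r. ap U (ap U (interp U ?s (num U n # ?\<gamma>)) (num U k)) r) k)" for n k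
  proof (induction k)
    case 0
    show ?case using p by simp
  next
    case (Suc k)
    have "LR U \<iota> (\<lambda>\<alpha>. num U k) (enc U (Leaf k))"
      by (auto intro: exI[of _ "Leaf k"])
    from LR_app[OF LR_app[OF t this] Suc] show ?case by (simp add: s del: interp.simps(5))
  qed
  have "ap U (interp U (Lam \<iota> ?R) ?\<gamma>) (num U n) = interp U ?R (num U n # ?\<gamma>)" for n
    using ok(1) typed env by (intro interp_beta[of _ ?\<Gamma> _ "trans_ty \<iota> \<sigma>"]) auto
  then have "LR U \<sigma> (?x n) (ap U (interp U (Lam \<iota> ?R) ?\<gamma>) (num U n))" for n
    using step[of n n] by (simp del: interp.simps(5))
  moreover have "interp U (Lam \<iota> ?R) ?\<gamma> \<in> carrier U (\<iota> \<Rrightarrow> trans_ty \<iota> \<sigma>)"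
    using ok(1) typed env by (intro interp_carrier) auto
  ultimately have "LR U \<sigma> (\<lambda>\<alpha>. ?x (dialogue T \<alpha>) \<alpha>)
      (ap U (ap U (interp U (ext_tm \<iota> \<sigma>) ?\<gamma>) (interp U (Lam \<iota> ?R) ?\<gamma>)) (enc U T))"
    by (intro LR_ext_tm[OF ok(4) env])
  then show ?case using T by (simp del: interp.simps(5))
next
  case (wt_Lam \<sigma> \<Gamma> t \<tau>)
  let ?\<Gamma> = "map (trans_ty \<iota>) \<Gamma>"
  note env = LR_env_env[OF wt_Lam.prems(3)]
  note typed = wt_trans_tm[OF wt_Lam.hyps, of \<iota>]
  have "interp U (Lam \<sigma> t) (map (\<lambda>p. fst p \<alpha>) \<epsilon>) \<in> carrier U (\<sigma> \<Rrightarrow> \<tau>)" for \<alpha>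
    using wt_Lam.hyps wt_Lam.prems(1) env(1) by (intro interp_carrier) auto
  moreover have "interp U (trans_tm \<iota> (Lam \<sigma> t)) (map snd \<epsilon>) \<in> carrier U (trans_ty \<iota> (\<sigma> \<Rrightarrow> \<tau>))"
    using typed wt_Lam.prems(2) env(2) by (intro interp_carrier) auto
  moreover have "LR U \<tau> (\<lambda>\<alpha>. ap U (interp U (Lam \<sigma> t) (map (\<lambda>p. fst p \<alpha>) \<epsilon>)) (x \<alpha>))
      (ap U (interp U (trans_tm \<iota> (Lam \<sigma> t)) (map snd \<epsilon>)) d)" if x: "LR U \<sigma> x d" for x d
  proof -
    have "ap U (interp U (Lam \<sigma> t) (map (\<lambda>p. fst p \<alpha>) \<epsilon>)) (x \<alpha>) =
        interp U t (map (\<lambda>p. fst p \<alpha>) ((x, d) # \<epsilon>))" for \<alpha>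
      using interp_beta[OF wt_Lam.hyps wt_Lam.prems(1) env(1) LR_carrier(1)[OF x]] by simp
    moreover have "ap U (interp U (trans_tm \<iota> (Lam \<sigma> t)) (map snd \<epsilon>)) d =
        interp U (trans_tm \<iota> t) (map snd ((x, d) # \<epsilon>))"
      using interp_beta[OF typed[simplified] wt_Lam.prems(2)[unfolded trans_tm.simps] env(2) LR_carrier(2)[OF x]]
      by simp
    ultimately show ?thesis
      using wt_Lam.IH[of "(x, d) # \<epsilon>"] wt_Lam.prems x by simp
  qed
  ultimately show ?case by (simp del: interp.simps(5) trans_tm.simps)
next
  case (wt_App \<Gamma> t \<sigma> \<tau> u)
  have "LR U (\<sigma> \<Rrightarrow> \<tau>) (\<lambda>\<alpha>. interp U t (map (\<lambda>p. fst p \<alpha>) \<epsilon>)) (interp U (trans_tm \<iota> t) (map snd \<epsilon>))"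
    and "LR U \<sigma> (\<lambda>\<alpha>. interp U u (map (\<lambda>p. fst p \<alpha>) \<epsilon>)) (interp U (trans_tm \<iota> u) (map snd \<epsilon>))"
    using wt_App.prems by (intro wt_App.IH; simp del: wt_simps)+
  from LR_app[OF this] show ?case by simp
qed

section \<open>The generic argument and the value of the modulus term\<close>

lemma code_seq_carrier: "code_seq U \<alpha> \<in> carrier U (\<iota> \<Rrightarrow> \<iota>)"
  unfolding code_seq_def by (intro code_carrier) simp

text \<open>The family is \<open>code_seq U\<close> itself, so the index of the relation becomes the
  argument; grafting \<open>Query Leaf\<close> onto the leaves looks up its value.\<close>

lemma LR_generic:
  assumes "faithful_tm U [] (generic \<iota>)"
  shows "LR U (\<iota> \<Rrightarrow> \<iota>) (code_seq U) (interp U (generic \<iota>) [])"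
proof -
  have F: "faithful U (\<iota> \<Rrightarrow> \<iota>)"
    using faithful_ChD by (auto simp: ChD_def dest!: faithful_arrD)
  have "ap U (code_seq U \<alpha>) (num U n) = num U (\<alpha> n)" for \<alpha> n
    unfolding code_seq_def using ap_code[OF F, of "\<lambda>x. num U (\<alpha> (nat_of U x))" "num U n"] by simp
  moreover have "interp U (generic \<iota>) [] \<in> carrier U (trans_ty \<iota> (\<iota> \<Rrightarrow> \<iota>))"
    using assms by (intro interp_carrier) auto
  moreover have "\<exists>T'. (\<forall>\<alpha>. num U (\<alpha> (dialogue T \<alpha>)) = num U (dialogue T' \<alpha>)) \<and>
      ap U (interp U (generic \<iota>) []) (enc U T) = enc U T'" for T
    using ap_generic[OF assms, of "[]" T]
    by (intro exI[of _ "bind T (Query Leaf)"]) (simp add: dialogue_bind)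
  ultimately show ?thesis
    by (auto simp: code_seq_carrier)
qed

text \<open>Both \<open>max_query\<close> and \<open>max_bq\<close> fold the tree with 0 at leaves
  and maxima over the answers 0 and 1; the successor turns the largest query into a strict
  bound.\<close>

lemma sem_modulus_uni:
  assumes mx: "[] \<turnstile> mx : \<iota> \<Rrightarrow> \<iota> \<Rrightarrow> \<iota>" and mx_max: "\<And>a b. sem_nat2 U mx a b = max a b"
    and ok: "faithful_tm U [] (modulus_uni mx)"
  shows "ap U (interp U (modulus_uni mx) []) (enc U T) = num U (Suc (max_query T))"
proof -
  \<comment> \<open>Closedness and uniqueness of types turn the typing of the unknown term
    \<open>mx\<close> into a rewrite rule valid in any context.\<close>
  have mx_simp [simp]: "\<Gamma> \<turnstile> mx : \<tau> \<longleftrightarrow> \<tau> = \<iota> \<Rrightarrow> \<iota> \<Rrightarrow> \<iota>" for \<Gamma> \<tau>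
    using wt_closed[OF mx] wt_unique by blast
  note [simp] = interp_closed[OF mx, of U "_ # _"]
  have F: "faithful U (\<iota> \<Rrightarrow> \<iota>)" "faithful U ((\<iota> \<Rrightarrow> \<iota>) \<Rrightarrow> \<iota> \<Rrightarrow> \<iota>)"
    using faithful_ChD by (auto simp: ChD_def dest!: faithful_arrD)
  let ?E = "Lam \<iota> Zero"
  let ?b = "mx \<cdot> Var 0 \<cdot> (mx \<cdot> (Var 1 \<cdot> numeral_tm 0) \<cdot> (Var 1 \<cdot> numeral_tm 1))"
  let ?B = "Lam (\<iota> \<Rrightarrow> \<iota>) (Lam \<iota> ?b)"
  \<comment> \<open>The tree is listed twice because \<open>modulus_uni\<close> and
    \<open>max_bq\<close> each bind it.\<close>
  let ?\<Gamma> = "[ChD \<iota> \<iota>, ChD \<iota> \<iota>]" and ?\<gamma> = "[enc U T, enc U T]"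
  note enc = enc_carrier[OF faithful_ChD]
  have ok': "faithful_tm U ?\<Gamma> ?E" "faithful_tm U ?\<Gamma> ?B" "faithful_tm U [ChD \<iota> \<iota>] (max_bq mx)"
    "faithful_tm U ([\<iota>, \<iota> \<Rrightarrow> \<iota>] @ ?\<Gamma>) mx"
    using ok by (simp_all add: modulus_uni_def max_bq_def del: wt_simps)
  then have mx_F: "faithful U (\<iota> \<Rrightarrow> \<iota> \<Rrightarrow> \<iota>)" and "faithful_tm U [] mx"
    using faithful_tm_type faithful_tm_closed[OF mx] mx_simp by blast+
  then have "interp U mx [] \<in> carrier U (\<iota> \<Rrightarrow> \<iota> \<Rrightarrow> \<iota>)"
    by (intro interp_carrier) auto
  then have ap_mx: "ap U (ap U (interp U mx []) (num U a)) (num U b) \<in> carrier U \<iota>" for a b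
    by (intro ap_carrier[OF F(1) ap_carrier[OF mx_F]]) auto
  \<comment> \<open>The assumption on \<open>mx\<close> gives the value only under
    \<open>nat_of\<close>; membership in the carrier shows that the value is a numeral, which
    \<open>nat_of\<close> determines.\<close>
  have mx_ap: "ap U (ap U (interp U mx []) (num U a)) (num U b) = num U (max a b)" for a b
  proof -
    obtain k where "ap U (ap U (interp U mx []) (num U a)) (num U b) = num U k"
      using ap_mx[of a b] by auto
    then show ?thesis using mx_max[of a b] by (simp add: sem_nat2_def)
  qed
  have env: "env U ?\<Gamma> ?\<gamma>" using enc by simp
  have E: "ap U (interp U ?E ?\<gamma>) (num U n) = num U 0" for n
    using interp_beta[of \<iota> ?\<Gamma> Zero \<iota> U ?\<gamma> "num U n"] ok'(1) env by (simp del: interp.simps(5))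
  have B: "ap U (ap U (interp U ?B ?\<gamma>) g) (num U i) = num U (max i (max a b))"
    if "g \<in> carrier U (\<iota> \<Rrightarrow> \<iota>)" "ap U g (num U 0) = num U a" "ap U g (num U 1) = num U b" for g i a b
    using interp_betas[of ?\<Gamma> "[\<iota> \<Rrightarrow> \<iota>, \<iota>]" ?b U ?\<gamma> "[g, num U i]"] ok'(2) env that
    by (simp add: mx_ap del: interp.simps(5) faithful_tm_simps)
  have EB: "interp U ?E ?\<gamma> \<in> carrier U (\<iota> \<Rrightarrow> \<iota>)"
    "interp U ?B ?\<gamma> \<in> carrier U ((\<iota> \<Rrightarrow> \<iota>) \<Rrightarrow> \<iota> \<Rrightarrow> \<iota>)"
    using env ok'(1,2) by (intro interp_carrier[of ?\<Gamma>]; simp)+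
  have fold: "fold_tree U (interp U ?E ?\<gamma>) (interp U ?B ?\<gamma>) S = num U (max_query S)" for S
  proof (induction S)
    case (Leaf n)
    show ?case using E by (simp del: interp.simps(5))
  next
    case (Query \<phi> i)
    let ?g = "code U (\<lambda>y\<in>carrier U \<iota>. num U (max_query (\<phi> (nat_of U y))))"
    have g: "?g \<in> carrier U (\<iota> \<Rrightarrow> \<iota>)"
      by (intro code_carrier) simp
    have ap_g: "ap U ?g (num U n) = num U (max_query (\<phi> n))" for n
      using ap_code[OF F(1), of "\<lambda>y. num U (max_query (\<phi> (nat_of U y)))" "num U n"] by simp
    \<comment> \<open>The induction hypothesis for all subtrees at once rewrites the continuation
      into \<open>?g\<close>, from which \<open>?B\<close> reads the answers at 0 and 1.\<close>
    show ?case
      unfolding fold_tree.simps max_query.simps Query.IH[OF rangeI] by (rule B[OF g ap_g ap_g])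
  qed
  have "ap U (interp U (max_bq mx) [enc U T]) (enc U T) =
      ap U (ap U (enc U T) (interp U ?E ?\<gamma>)) (interp U ?B ?\<gamma>)"
    using interp_beta[of "ChD \<iota> \<iota>" "[ChD \<iota> \<iota>]" "Var 0 \<cdot> ?E \<cdot> ?B" \<iota> U "[enc U T]" "enc U T"]
      ok'(3) enc[of T]
    unfolding max_bq_def by (simp add: ChD_def del: interp.simps(5) faithful_tm_simps)
  also have "\<dots> = num U (max_query T)"
    using ap_enc[OF faithful_ChD EB] fold by simp
  finally have "ap U (interp U (max_bq mx) [enc U T]) (enc U T) = num U (max_query T)" .
  moreover have "[ChD \<iota> \<iota>] \<turnstile> max_bq mx : ChD \<iota> \<iota> \<Rrightarrow> \<iota>"
    by (simp add: max_bq_def ChD_def)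
  ultimately show ?thesis
    using interp_beta[of "ChD \<iota> \<iota>" "[]" "Succ (max_bq mx \<cdot> Var 0)" \<iota> U "[]" "enc U T"] ok enc
    unfolding modulus_uni_def by (simp del: interp.simps(5) faithful_tm_simps)
qed

end

section \<open>Uniform continuity read off from the tree of \<open>t\<close>\<close>

theorem theorem55:
  fixes U :: "'u coding" and mx t :: tm
  assumes mx_typed: "[] \<turnstile> mx : \<iota> \<Rrightarrow> \<iota> \<Rrightarrow> \<iota>"
    and t_typed: "[] \<turnstile> t : (\<iota> \<Rrightarrow> \<iota>) \<Rrightarrow> \<iota>"
    and U: "set_universe U
              (occ_types t [] \<union> occ_types (modulus_uni mx \<cdot> dialogue_tree \<iota> t) [])"
    and mx_max: "\<And>a b. sem_nat2 U mx a b = max a b"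
  shows "is_modulus_of_uniform_continuity
           (sem_nat U (modulus_uni mx \<cdot> dialogue_tree \<iota> t))
           (sem_fun U t \<circ> embed_bool)"
proof -
  let ?m = "modulus_uni mx \<cdot> dialogue_tree \<iota> t"
  have "faithful U \<rho>" if "\<rho> \<in> occ_types t [] \<union> occ_types ?m []" for \<rho>
    using U that unfolding set_universe_def by (intro faithfulI) blast
  then have t: "faithful_tm U [] t" and m: "faithful_tm U [] (modulus_uni mx)"
    and d: "faithful_tm U [] (dialogue_tree \<iota> t)"
    by (auto simp: faithful_tm_def)
  have t': "[] \<turnstile> trans_tm \<iota> t : (ChD \<iota> \<iota> \<Rrightarrow> ChD \<iota> \<iota>) \<Rrightarrow> ChD \<iota> \<iota>"
    using wt_trans_tm[OF t_typed, of \<iota>] by simp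
  then have "[] \<turnstile> dialogue_tree \<iota> t : ChD \<iota> \<iota>"
    by (simp add: dialogue_tree_def)
  with d have "faithful U (ChD \<iota> \<iota>)" by (rule faithful_tm_type)
  moreover have "inj (num U)" using U by (simp add: set_universe_def)
  ultimately interpret dialogue_coding U by unfold_locales
  from d have "faithful_tm U [] (trans_tm \<iota> t)" "faithful_tm U [] (generic \<iota>)"
    by (simp_all add: dialogue_tree_def del: wt_simps)
  \<comment> \<open>With the empty environment \<open>t\<close> itself does not vary with \<alpha>;
    only the generic argument does, so one tree computes \<open>t\<close> at every sequence.\<close>
  then have "LR U \<iota> (\<lambda>\<alpha>. ap U (interp U t []) (code_seq U \<alpha>)) (interp U (dialogue_tree \<iota> t) [])"
    using LR_app[OF LR_interp[OF t_typed t, of "[]"] LR_generic] by (simp add: dialogue_tree_def)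
  then obtain T where T: "\<And>\<alpha>. sem_fun U t \<alpha> = dialogue T \<alpha>"
    and "interp U (dialogue_tree \<iota> t) [] = enc U T"
    by (auto simp: sem_fun_def)
  then have "sem_nat U ?m = Suc (max_query T)"
    using sem_modulus_uni[OF mx_typed mx_max m] by (simp add: sem_nat_def)
  \<comment> \<open>The modulus exceeds \<open>max_query T\<close> by one, so agreement strictly
    below it covers every query up to \<open>max_query T\<close>.\<close>
  with T show ?thesis
    unfolding is_modulus_of_uniform_continuity_def
    by (auto intro!: dialogue_embed_bool_cong)
qed

end
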